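(* Let $D$ be an integral domain with quotient field $K$, let $\Theta$ be a pre-Jaffard family of $D$, let $\{T_\alpha\}$, $\{\Theta_\alpha\}$ be its derived sequence and the associated chain of subsets of $\Theta$, let $\alpha$ be an ordinal, and let $\Theta':=(\Theta\setminus\Theta_\alpha)\cup\{T_\alpha\}$. Then: (1) for every stable semistar operation $\star$ on $D$ and every $D$-submodule $I$ of $K$, $I^\star=\bigcap\{(IT)^\star\mid T\in\Theta'\}$; (2) $\mathrm{SStar}_{\mathrm{st}}(D)\simeq\prod\{\mathrm{SStar}_{\mathrm{st}}(T)\mid T\in\Theta'\}$ as partially ordered sets (the product having the product order).
   Context: All rings are integral domains; "compact" means quasi-compact. Let $E$ be a domain with quotient field $K$. An overring of $E$ is a ring $T$ with $E\subseteq T\subseteq K$; $\mathrm{Over}(E)$ is the set of overrings. The Zariski topology on $\mathrm{Over}(E)$ has as subbasis of open sets the sets $\mathcal B(x_1,\dots,x_n)=\{T\mid x_1,\dots,x_n\in T\}$, $x_i\in K$. For an overring $T$ put $\sigma(T)=\{Q\cap E\mid Q\in\mathrm{Spec}(T)\}$. An overring is flat if it is a flat $E$-module. A family $\Theta$ of overrings of $E$ is: - complete if $I=\bigcap\{IT\mid T\in\Theta\}$ for every ideal $I$ of $E$; - independent if $\sigma(A)\cap\sigma(B)=\{(0)\}$ for all distinct $A,B\in\Theta$; - locally finite if every nonzero $x\in K$ is a nonunit in only finitely many members of $\Theta$. $\Theta$ is a Jaffard family of $E$ if: either $K\notin\Theta$ or $\Theta=\{K\}$; every $T\in\Theta$ is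 flat over $E$; $\Theta$ is complete, independent and locally finite. A Jaffard overring of $E$ is a member of some Jaffard family of $E$. $\Theta$ is a pre-Jaffard family of $E$ if: either $K\notin\Theta$ or $\Theta=\{K\}$; every $T\in\Theta$ is flat over $E$; $\Theta$ is complete, independent, and compact in the Zariski topology. Derived sequence of a pre-Jaffard family $\Theta$ of $D$: $T_0:=D$, $\Theta_0:=\Theta$. For $\alpha=\gamma+1$, $\Theta_\alpha:=\Theta_\gamma\setminus(\Theta_\gamma)_J$, where $(\Theta_\gamma)_J$ is the set of those members of $\Theta_\gamma$ that are Jaffard overrings of $T_\gamma$. For $\alpha$ a limit ordinal, $\Theta_\alpha:=\bigcap_{\beta<\alpha}\Theta_\beta$. In both cases $T_\alpha:=\bigcap\{S\mid S\in\Theta_\alpha\}$, with $T_\alpha:=K$ if $\Theta_\alpha=\emptyset$. For a domain $E$ with quotient field $K$, let $\mathbf F_E(K)$ be the set of $E$-submodules of $K$. A semistar operation on $E$ is a map $\star:\mathbf F_E(K)\to\mathbf F_E(K)$, $I\mapsto I^\star$, such that for all $I,J\in\mathbf F_E(K)$ and $x\in K$: $I\subseteq I^\star$; $I\subseteq J$ implies $I^\star\subseteq J^\star$; $(I^\star)^\star=I^\star$; $x\cdot I^\star=(xI)^\star$. It is stable if $(I\cap J)^\star=I^\star\cap J^\star$ for all $I,J$. $\mathrm{SStar}_{\mathrm{st}}(E)$ is the set of stable semistar operations on $E$, ordered by $\star_1\le\star_2$ iff $I^{\star_1}\subseteq I^{\star_2}$ for every $I$. *)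

theory Defs
  imports "HOL-Algebra.Algebra" "HOL-Analysis.Abstract_Topology"
begin

text \<open>
  Domains and their overrings are subsets of one fixed field \<open>K\<close>; a subring \<open>E\<close> of \<open>K\<close> is
  turned into a ring by restricting the carrier, \<open>K\<lparr>carrier := E\<rparr>\<close>.
\<close>

definition quotient_field :: "('a, 'b) ring_scheme \<Rightarrow> 'a set \<Rightarrow> bool" where
  "quotient_field K D \<longleftrightarrow> field K \<and> subdomain D K \<and>
     (\<forall>x\<in>carrier K. \<exists>a\<in>D. \<exists>b\<in>D - {\<zero>\<^bsub>K\<^esub>}. x = a \<otimes>\<^bsub>K\<^esub> inv\<^bsub>K\<^esub> b)"

definition overrings :: "('a, 'b) ring_scheme \<Rightarrow> 'a set \<Rightarrow> 'a set set" where
  "overrings K E = {T. subring T K \<and> E \<subseteq> T}"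

definition zariski :: "('a, 'b) ring_scheme \<Rightarrow> 'a set \<Rightarrow> 'a set topology" where
  "zariski K E = topology_generated_by
     {{T \<in> overrings K E. S \<subseteq> T} |S. finite S \<and> S \<subseteq> carrier K}"


subsection \<open>Flat modules\<close>

definition module_hom ::
  "('a, 'b) ring_scheme \<Rightarrow> ('a, 'm, 'c) module_scheme \<Rightarrow> ('a, 'n, 'd) module_scheme \<Rightarrow> ('m \<Rightarrow> 'n) set" where
  "module_hom R M N = {f \<in> hom (add_monoid M) (add_monoid N).
     \<forall>r\<in>carrier R. \<forall>x\<in>carrier M. f (r \<odot>\<^bsub>M\<^esub> x) = r \<odot>\<^bsub>N\<^esub> f x}"

text \<open>
  The tensor product of \<open>M\<close> and \<open>N\<close> over \<open>R\<close> is the free abelian group on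
  \<open>carrier M \<times> carrier N\<close> modulo the subgroup generated by the usual bilinearity relations.
\<close>

definition tensor_relations ::
  "('a, 'b) ring_scheme \<Rightarrow> ('a, 'm, 'c) module_scheme \<Rightarrow> ('a, 'n, 'd) module_scheme
     \<Rightarrow> (('m \<times> 'n) \<Rightarrow>\<^sub>0 int) set" where
  "tensor_relations R M N = generate (free_Abelian_group (carrier M \<times> carrier N))
     ({frag_of (x \<oplus>\<^bsub>M\<^esub> x', y) - frag_of (x, y) - frag_of (x', y) |x x' y.
          x \<in> carrier M \<and> x' \<in> carrier M \<and> y \<in> carrier N}
    \<union> {frag_of (x, y \<oplus>\<^bsub>N\<^esub> y') - frag_of (x, y) - frag_of (x, y') |x y y'.
          x \<in> carrier M \<and> y \<in> carrier N \<and> y' \<in> carrier N}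
    \<union> {frag_of (r \<odot>\<^bsub>M\<^esub> x, y) - frag_of (x, r \<odot>\<^bsub>N\<^esub> y) |r x y.
          r \<in> carrier R \<and> x \<in> carrier M \<and> y \<in> carrier N})"

definition tensor_product ::
  "('a, 'b) ring_scheme \<Rightarrow> ('a, 'm, 'c) module_scheme \<Rightarrow> ('a, 'n, 'd) module_scheme
     \<Rightarrow> (('m \<times> 'n) \<Rightarrow>\<^sub>0 int) set monoid" where
  "tensor_product R M N =
     free_Abelian_group (carrier M \<times> carrier N) Mod tensor_relations R M N"

text \<open>
  The map induced by \<open>f : M \<rightarrow> M'\<close> on the tensor products with \<open>N\<close>, as a map of cosets; all
  members of the union coincide.
\<close>

definition tensor_map ::
  "('a, 'b) ring_scheme \<Rightarrow> ('a, 'k, 'd) module_scheme \<Rightarrow> ('a, 'n, 'e) module_scheme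
     \<Rightarrow> ('m \<Rightarrow> 'k) \<Rightarrow> (('m \<times> 'n) \<Rightarrow>\<^sub>0 int) set \<Rightarrow> (('k \<times> 'n) \<Rightarrow>\<^sub>0 int) set" where
  "tensor_map R M' N f C =
     (\<Union>c\<in>C. tensor_relations R M' N
        #>\<^bsub>free_Abelian_group (carrier M' \<times> carrier N)\<^esub> frag_extend (\<lambda>(x, y). frag_of (f x, y)) c)"

text \<open>
  A module is flat if tensoring with it preserves injectivity. HOL cannot quantify over all
  modules of all types here. The test modules have elements of type \<open>(nat \<Rightarrow> 'a) set\<close>: the cosets
  in a quotient of a free module \<open>R\<^sup>n\<close> have this type, so every finitely generated module has an
  isomorphic copy there. Nothing is lost: an element of a kernel, and
  the relations witnessing that its image vanishes, involve only finitely many elements of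
  the two modules, so flatness can be tested on finitely generated modules.
\<close>

definition flat_module :: "('a, 'b) ring_scheme \<Rightarrow> ('a, 'n, 'c) module_scheme \<Rightarrow> bool" where
  "flat_module R N \<longleftrightarrow> module R N \<and>
     (\<forall>(M :: ('a, (nat \<Rightarrow> 'a) set) module) (M' :: ('a, (nat \<Rightarrow> 'a) set) module) f.
        module R M \<and> module R M' \<and> f \<in> module_hom R M M' \<and> inj_on f (carrier M)
        \<longrightarrow> inj_on (tensor_map R M' N f) (carrier (tensor_product R M N)))"

definition as_module :: "('a, 'b) ring_scheme \<Rightarrow> 'a set \<Rightarrow> ('a, 'a) module" where
  "as_module K T = \<lparr>carrier = T, monoid.mult = monoid.mult K, one = \<one>\<^bsub>K\<^esub>,
     ring.zero = \<zero>\<^bsub>K\<^esub>, ring.add = ring.add K, smult = monoid.mult K\<rparr>"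

definition flat_overring :: "('a, 'b) ring_scheme \<Rightarrow> 'a set \<Rightarrow> 'a set \<Rightarrow> bool" where
  "flat_overring K E T \<longleftrightarrow> T \<in> overrings K E \<and> flat_module (K\<lparr>carrier := E\<rparr>) (as_module K T)"


subsection \<open>Families of overrings\<close>

text \<open>
  \<open>ideal_prod K I T\<close>, written \<open>I \<cdot>\<^bsub>K\<^esub> T\<close>, is the set of finite sums of products \<open>i \<otimes> t\<close>, that is,
  the extension \<open>IT\<close>. The intersection with \<open>carrier K\<close> only matters for the empty family.
\<close>

definition complete_family :: "('a, 'b) ring_scheme \<Rightarrow> 'a set \<Rightarrow> 'a set set \<Rightarrow> bool" where
  "complete_family K E \<Theta> \<longleftrightarrow>
     (\<forall>I. ideal I (K\<lparr>carrier := E\<rparr>) \<longrightarrow> I = carrier K \<inter> (\<Inter>T\<in>\<Theta>. I \<cdot>\<^bsub>K\<^esub> T))"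

definition contracted_primes :: "('a, 'b) ring_scheme \<Rightarrow> 'a set \<Rightarrow> 'a set \<Rightarrow> 'a set set" where
  "contracted_primes K E T = {Q \<inter> E |Q. primeideal Q (K\<lparr>carrier := T\<rparr>)}"

definition independent_family :: "('a, 'b) ring_scheme \<Rightarrow> 'a set \<Rightarrow> 'a set set \<Rightarrow> bool" where
  "independent_family K E \<Theta> \<longleftrightarrow> (\<forall>A\<in>\<Theta>. \<forall>B\<in>\<Theta>. A \<noteq> B \<longrightarrow>
     contracted_primes K E A \<inter> contracted_primes K E B = {{\<zero>\<^bsub>K\<^esub>}})"

definition locally_finite_family :: "('a, 'b) ring_scheme \<Rightarrow> 'a set set \<Rightarrow> bool" where
  "locally_finite_family K \<Theta> \<longleftrightarrow>
     (\<forall>x\<in>carrier K - {\<zero>\<^bsub>K\<^esub>}. finite {T \<in> \<Theta>. x \<notin> Units (K\<lparr>carrier := T\<rparr>)})"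

definition jaffard_family :: "('a, 'b) ring_scheme \<Rightarrow> 'a set \<Rightarrow> 'a set set \<Rightarrow> bool" where
  "jaffard_family K E \<Theta> \<longleftrightarrow> \<Theta> \<subseteq> overrings K E \<and>
     (carrier K \<notin> \<Theta> \<or> \<Theta> = {carrier K}) \<and>
     (\<forall>T\<in>\<Theta>. flat_overring K E T) \<and>
     complete_family K E \<Theta> \<and> independent_family K E \<Theta> \<and> locally_finite_family K \<Theta>"

definition jaffard_overring :: "('a, 'b) ring_scheme \<Rightarrow> 'a set \<Rightarrow> 'a set \<Rightarrow> bool" where
  "jaffard_overring K E T \<longleftrightarrow> (\<exists>\<Theta>. jaffard_family K E \<Theta> \<and> T \<in> \<Theta>)"

definition pre_jaffard_family :: "('a, 'b) ring_scheme \<Rightarrow> 'a set \<Rightarrow> 'a set set \<Rightarrow> bool" where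
  "pre_jaffard_family K E \<Theta> \<longleftrightarrow> \<Theta> \<subseteq> overrings K E \<and>
     (carrier K \<notin> \<Theta> \<or> \<Theta> = {carrier K}) \<and>
     (\<forall>T\<in>\<Theta>. flat_overring K E T) \<and>
     complete_family K E \<Theta> \<and> independent_family K E \<Theta> \<and> compactin (zariski K E) \<Theta>"


subsection \<open>The derived sequence\<close>

text \<open>
  Ordinals are the elements of an arbitrary well-ordered type \<open>'i\<close>, an element standing for the
  order type of the set of its predecessors; every ordinal occurs in some such type.
\<close>

definition is_first :: "'i::wellorder \<Rightarrow> bool" where
  "is_first \<alpha> \<longleftrightarrow> (\<forall>\<beta>. \<alpha> \<le> \<beta>)"

definition is_succ_of :: "'i::wellorder \<Rightarrow> 'i \<Rightarrow> bool" where
  "is_succ_of \<alpha> \<gamma> \<longleftrightarrow> \<gamma> < \<alpha> \<and> (\<forall>\<beta><\<alpha>. \<beta> \<le> \<gamma>)"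

definition is_limit :: "'i::wellorder \<Rightarrow> bool" where
  "is_limit \<alpha> \<longleftrightarrow> \<not> is_first \<alpha> \<and> (\<nexists>\<gamma>. is_succ_of \<alpha> \<gamma>)"

lemma is_succ_of_less: "is_succ_of \<alpha> \<gamma> \<Longrightarrow> \<gamma> < \<alpha>"
  by (simp add: is_succ_of_def)

lemma is_succ_of_unique: "is_succ_of \<alpha> \<gamma> \<Longrightarrow> is_succ_of \<alpha> \<gamma>' \<Longrightarrow> \<gamma>' = \<gamma>"
  by (auto simp: is_succ_of_def intro: antisym)

lemma the_is_succ_of: "is_succ_of \<alpha> \<gamma> \<Longrightarrow> (THE \<gamma>. is_succ_of \<alpha> \<gamma>) = \<gamma>"
  by (blast intro: is_succ_of_unique)

text \<open>The ring \<open>T\<^sub>\<alpha>\<close> attached to the \<open>\<alpha>\<close>-th family \<open>\<Phi> = \<Theta>\<^sub>\<alpha>\<close>; for \<open>\<Phi> = {}\<close> and \<open>\<alpha>\<close> not first it is \<open>K\<close>.\<close>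

definition stage_ring :: "('a, 'b) ring_scheme \<Rightarrow> 'a set \<Rightarrow> 'i::wellorder \<Rightarrow> 'a set set \<Rightarrow> 'a set" where
  "stage_ring K D \<alpha> \<Phi> = (if is_first \<alpha> then D else if \<Phi> = {} then carrier K else \<Inter>\<Phi>)"

function derived_family ::
  "('a, 'b) ring_scheme \<Rightarrow> 'a set \<Rightarrow> 'a set set \<Rightarrow> 'i::wellorder \<Rightarrow> 'a set set" where
  "derived_family K D \<Theta> \<alpha> =
     (if is_first \<alpha> then \<Theta>
      else if \<exists>\<gamma>. is_succ_of \<alpha> \<gamma> then
        (let \<gamma> = (THE \<gamma>. is_succ_of \<alpha> \<gamma>); \<Phi> = derived_family K D \<Theta> \<gamma>
         in \<Phi> - {T \<in> \<Phi>. jaffard_overring K (stage_ring K D \<gamma> \<Phi>) T})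
      else (\<Inter>\<beta>\<in>{..<\<alpha>}. derived_family K D \<Theta> \<beta>))"
  by pat_completeness auto
termination
  by (relation "inv_image {(\<beta>, \<alpha>). \<beta> < \<alpha>} (\<lambda>(K, D, \<Theta>, \<alpha>). \<alpha>)")
    (auto simp: the_is_succ_of intro!: wf_inv_image wf dest: is_succ_of_less)

declare derived_family.simps [simp del]

definition derived_ring ::
  "('a, 'b) ring_scheme \<Rightarrow> 'a set \<Rightarrow> 'a set set \<Rightarrow> 'i::wellorder \<Rightarrow> 'a set" where
  "derived_ring K D \<Theta> \<alpha> = stage_ring K D \<alpha> (derived_family K D \<Theta> \<alpha>)"

lemma derived_family_first: "is_first \<alpha> \<Longrightarrow> derived_family K D \<Theta> \<alpha> = \<Theta>"
  by (simp add: derived_family.simps)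

lemma derived_family_succ:
  assumes "is_succ_of \<alpha> \<gamma>"
  shows "derived_family K D \<Theta> \<alpha> = derived_family K D \<Theta> \<gamma> -
    {T \<in> derived_family K D \<Theta> \<gamma>. jaffard_overring K (derived_ring K D \<Theta> \<gamma>) T}"
proof -
  have "\<not> is_first \<alpha>"
    using assms by (auto simp: is_first_def is_succ_of_def not_le)
  then show ?thesis
    using assms
    by (subst derived_family.simps) (auto simp: the_is_succ_of derived_ring_def Let_def)
qed

lemma derived_family_limit:
  "is_limit \<alpha> \<Longrightarrow> derived_family K D \<Theta> \<alpha> = (\<Inter>\<beta>\<in>{..<\<alpha>}. derived_family K D \<Theta> \<beta>)"
  by (subst derived_family.simps) (auto simp: is_limit_def)

lemma derived_ring_first: "is_first \<alpha> \<Longrightarrow> derived_ring K D \<Theta> \<alpha> = D"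
  by (simp add: derived_ring_def stage_ring_def)

lemma derived_ring_not_first:
  "\<not> is_first \<alpha> \<Longrightarrow> derived_ring K D \<Theta> \<alpha> =
     (if derived_family K D \<Theta> \<alpha> = {} then carrier K else \<Inter>(derived_family K D \<Theta> \<alpha>))"
  by (simp add: derived_ring_def stage_ring_def)


subsection \<open>Stable semistar operations\<close>

definition submodules :: "('a, 'b) ring_scheme \<Rightarrow> 'a set \<Rightarrow> 'a set set" where
  "submodules K E = {I. submodule I (K\<lparr>carrier := E\<rparr>) (as_module K (carrier K))}"

text \<open>
  Maps on \<open>submodules K E\<close> are extensional, so that equality of operations is equality on
  \<open>submodules K E\<close>. The scalar \<open>x = 0\<close> is included; it forces the zero module to be closed.
\<close>

definition semistar_operation ::
  "('a, 'b) ring_scheme \<Rightarrow> 'a set \<Rightarrow> ('a set \<Rightarrow> 'a set) \<Rightarrow> bool" where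
  "semistar_operation K E s \<longleftrightarrow>
     s \<in> submodules K E \<rightarrow>\<^sub>E submodules K E \<and>
     (\<forall>I\<in>submodules K E. I \<subseteq> s I) \<and>
     (\<forall>I\<in>submodules K E. \<forall>J\<in>submodules K E. I \<subseteq> J \<longrightarrow> s I \<subseteq> s J) \<and>
     (\<forall>I\<in>submodules K E. s (s I) = s I) \<and>
     (\<forall>I\<in>submodules K E. \<forall>x\<in>carrier K. x <#\<^bsub>K\<^esub> s I = s (x <#\<^bsub>K\<^esub> I))"

definition stable_operation ::
  "('a, 'b) ring_scheme \<Rightarrow> 'a set \<Rightarrow> ('a set \<Rightarrow> 'a set) \<Rightarrow> bool" where
  "stable_operation K E s \<longleftrightarrow>
     (\<forall>I\<in>submodules K E. \<forall>J\<in>submodules K E. s (I \<inter> J) = s I \<inter> s J)"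

definition SStar_st :: "('a, 'b) ring_scheme \<Rightarrow> 'a set \<Rightarrow> ('a set \<Rightarrow> 'a set) gorder" where
  "SStar_st K E =
     \<lparr>carrier = {s. semistar_operation K E s \<and> stable_operation K E s},
      eq = (=),
      le = (\<lambda>s s'. \<forall>I\<in>submodules K E. s I \<subseteq> s' I)\<rparr>"


subsection \<open>Products and isomorphisms of partially ordered sets\<close>

definition product_order :: "'j set \<Rightarrow> ('j \<Rightarrow> ('c, 'd) gorder_scheme) \<Rightarrow> ('j \<Rightarrow> 'c) gorder" where
  "product_order J P =
     \<lparr>carrier = (\<Pi>\<^sub>E j\<in>J. carrier (P j)),
      eq = (=),
      le = (\<lambda>f g. \<forall>j\<in>J. f j \<sqsubseteq>\<^bsub>P j\<^esub> g j)\<rparr>"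

definition order_isomorphic :: "('c, 'd) gorder_scheme \<Rightarrow> ('e, 'f) gorder_scheme \<Rightarrow> bool" where
  "order_isomorphic A B \<longleftrightarrow> partial_order A \<and> partial_order B \<and>
     (\<exists>f. bij_betw f (carrier A) (carrier B) \<and> order_emb A B f)"

end

theory Submission
  imports Defs
begin

text \<open>
  Let \<open>T\<close> be removed at stage \<open>\<rho>\<close> and let \<open>S\<close> be the intersection of the other members of a Jaffard family
  of \<open>T\<^sub>\<rho>\<close> containing \<open>T\<close>. Local finiteness and independence give \<open>(dS \<inter> T\<^sub>\<rho>)T = T\<close> for all \<open>d \<noteq> 0\<close>, in
  particular \<open>ST = K\<close>, and every other member of \<open>\<Theta>\<^sub>\<rho>\<close> contains \<open>S\<close>. Two facts follow. First, \<open>\<Theta>\<^sub>\<alpha>\<close> is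
  complete over \<open>T\<^sub>\<alpha>\<close>: a nonzero prime of \<open>T\<^sub>\<alpha>\<close> cannot contract to a prime surviving in a removed \<open>T\<close>.
  Second, by compactness of \<open>\<Theta>\<close>, each finite subset of \<open>T\<^sub>\<alpha>\<close> is, for some \<open>\<beta> < \<alpha>\<close>, contained in all but finitely
  many members of \<open>\<Theta>\<^sub>\<beta>\<close>, the exceptions being outside \<open>\<Theta>\<^sub>\<alpha>\<close>.

  Part (1) is then a well-founded induction on \<open>\<alpha>\<close>. If \<open>x \<in> (IT)\<^sup>\<star>\<close> for all \<open>T\<close>, then \<open>x \<in> J\<^sup>\<star>\<close> for
  \<open>J = IT\<^sub>\<alpha> \<inter> xD\<close>, so it suffices that \<open>J \<subseteq> I\<^sup>\<star>\<close>. An element \<open>y\<close> of \<open>J\<close> involves finitely many elements of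
  \<open>T\<^sub>\<alpha>\<close>, so \<open>y \<in> IT\<close> for all \<open>T \<in> \<Theta>\<^sub>\<beta>\<close> outside a finite set; as \<open>\<star>\<close> commutes with finite intersections,
  \<open>y \<in> (IT\<^sub>\<beta>)\<^sup>\<star>\<close>, and the induction hypothesis for \<open>\<beta>\<close> applies to \<open>y\<close>. Part (2) follows because
  \<open>TB = K\<close> for distinct \<open>T, B \<in> \<Theta>'\<close>.
\<close>

section \<open>Submodules of the quotient field and extension of scalars\<close>

lemma quotient_field_overring:
  assumes "quotient_field K D" "T \<in> overrings K D"
  shows "quotient_field K T"
proof -
  interpret field K
    using assms by (auto simp: quotient_field_def)
  have T: "subring T K" "D \<subseteq> T"
    using assms by (auto simp: overrings_def)
  have "subdomain T K"
    using subdomainI[OF subcringI'[OF T(1)]] subringE(1)[OF T(1)] integral by (simp add: subset_iff)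
  then show ?thesis
    using assms T unfolding quotient_field_def by (meson Diff_iff subsetD field_axioms)
qed

context field
begin

text \<open>Multiplying by -1, which lies in \<open>E\<close>, produces negatives, so closure under
  addition and scalars already yields an additive subgroup.\<close>

lemma submodules_iff:
  assumes "subring E R"
  shows "I \<in> submodules R E \<longleftrightarrow> I \<subseteq> carrier R \<and> \<zero> \<in> I \<and> (\<forall>x\<in>I. \<forall>y\<in>I. x \<oplus> y \<in> I) \<and>
     (\<forall>e\<in>E. \<forall>x\<in>I. e \<otimes> x \<in> I)"
proof
  assume "I \<in> submodules R E"
  then interpret submodule I "R\<lparr>carrier := E\<rparr>" "as_module R (carrier R)"
    by (simp add: submodules_def)
  show "I \<subseteq> carrier R \<and> \<zero> \<in> I \<and> (\<forall>x\<in>I. \<forall>y\<in>I. x \<oplus> y \<in> I) \<and> (\<forall>e\<in>E. \<forall>x\<in>I. e \<otimes> x \<in> I)"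
    using subset m_closed one_closed smult_closed by (auto simp: as_module_def)
next
  assume I: "I \<subseteq> carrier R \<and> \<zero> \<in> I \<and> (\<forall>x\<in>I. \<forall>y\<in>I. x \<oplus> y \<in> I) \<and> (\<forall>e\<in>E. \<forall>x\<in>I. e \<otimes> x \<in> I)"
  have neg: "\<ominus> x \<in> I" if "x \<in> I" for x
  proof -
    have "(\<ominus> \<one>) \<otimes> x \<in> I"
      using I that subringE[OF assms] by blast
    then show ?thesis
      using I that by (metis l_minus l_one one_closed subsetD)
  qed
  have "subgroup I (add_monoid R)"
    using I neg by (intro add.subgroupI) (auto simp: a_inv_def)
  then have "subgroup I (add_monoid (as_module R (carrier R)))"
    by (simp add: as_module_def subgroup_def m_inv_def)
  then show "I \<in> submodules R E"
    using I by (simp add: submodules_def submodule_def submodule_axioms_def as_module_def)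
qed

lemma submodulesI:
  assumes "subring E R" "I \<subseteq> carrier R" "\<zero> \<in> I" "\<And>x y. x \<in> I \<Longrightarrow> y \<in> I \<Longrightarrow> x \<oplus> y \<in> I"
    "\<And>e x. e \<in> E \<Longrightarrow> x \<in> I \<Longrightarrow> e \<otimes> x \<in> I"
  shows "I \<in> submodules R E"
  using assms by (simp add: submodules_iff)

lemma submodulesD:
  assumes "subring E R" "I \<in> submodules R E"
  shows "I \<subseteq> carrier R" "\<zero> \<in> I" "\<And>x y. x \<in> I \<Longrightarrow> y \<in> I \<Longrightarrow> x \<oplus> y \<in> I"
    "\<And>e x. e \<in> E \<Longrightarrow> x \<in> I \<Longrightarrow> e \<otimes> x \<in> I"
  using assms by (auto simp: submodules_iff)

lemma submodules_neg:
  assumes "subring E R" "I \<in> submodules R E" "x \<in> I"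
  shows "\<ominus> x \<in> I"
proof -
  have "(\<ominus> \<one>) \<otimes> x \<in> I"
    by (intro submodulesD(4)[OF assms(1,2)] assms(3) subringE(3,5)[OF assms(1)])
  then show ?thesis
    using submodulesD(1)[OF assms(1,2)] assms(3) by (metis l_minus l_one one_closed subsetD)
qed

lemma submodules_antimono:
  assumes "subring E R" "subring T R" "E \<subseteq> T"
  shows "submodules R T \<subseteq> submodules R E"
  using assms by (force simp: submodules_iff)

lemma subring_self_submodule: "subring E R \<Longrightarrow> E \<in> submodules R E"
  by (auto simp: submodules_iff subringE(1,2,6,7) intro: subsetD[OF subringE(1)])

lemma overring_submodule:
  "subring E R \<Longrightarrow> subring T R \<Longrightarrow> E \<subseteq> T \<Longrightarrow> T \<in> submodules R E"
  using submodules_antimono subring_self_submodule by blast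

lemma submodules_Int:
  "subring E R \<Longrightarrow> I \<in> submodules R E \<Longrightarrow> J \<in> submodules R E \<Longrightarrow> I \<inter> J \<in> submodules R E"
  by (auto simp: submodules_iff)

lemma submodules_INT:
  "subring E R \<Longrightarrow> A \<noteq> {} \<Longrightarrow> (\<And>a. a \<in> A \<Longrightarrow> f a \<in> submodules R E)
    \<Longrightarrow> (\<Inter>a\<in>A. f a) \<in> submodules R E"
  by (rule submodulesI) (auto dest: submodulesD)

lemma mem_scale: "z \<in> x <#\<^bsub>R\<^esub> I \<longleftrightarrow> (\<exists>i\<in>I. z = x \<otimes> i)"
  by (auto simp: l_coset_def)

lemma submodules_scale:
  assumes E: "subring E R" and I: "I \<in> submodules R E" and x: "x \<in> carrier R"
  shows "x <#\<^bsub>R\<^esub> I \<in> submodules R E"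
proof (rule submodulesI[OF E])
  note D = submodulesD[OF E I]
  show "x <#\<^bsub>R\<^esub> I \<subseteq> carrier R" "\<zero> \<in> x <#\<^bsub>R\<^esub> I"
    using D(1,2) x by (auto simp: mem_scale subset_iff intro!: bexI[of _ \<zero>])
  show "y \<oplus> z \<in> x <#\<^bsub>R\<^esub> I" if yz: "y \<in> x <#\<^bsub>R\<^esub> I" "z \<in> x <#\<^bsub>R\<^esub> I" for y z
  proof -
    obtain i j where ij: "i \<in> I" "j \<in> I" "y = x \<otimes> i" "z = x \<otimes> j"
      using yz by (auto simp: mem_scale)
    then have "y \<oplus> z = x \<otimes> (i \<oplus> j)"
      using D(1) x by (simp add: r_distr subset_iff)
    then show ?thesis
      using D(3) ij by (auto simp: mem_scale)
  qed
  show "e \<otimes> z \<in> x <#\<^bsub>R\<^esub> I" if ez: "e \<in> E" "z \<in> x <#\<^bsub>R\<^esub> I" for e z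
  proof -
    obtain i where i: "i \<in> I" "z = x \<otimes> i"
      using ez by (auto simp: mem_scale)
    then have "e \<otimes> z = x \<otimes> (e \<otimes> i)"
      using D(1) x ez subringE(1)[OF E] by (simp add: m_lcomm subset_iff)
    then show ?thesis
      using D(4) i ez by (auto simp: mem_scale)
  qed
qed

lemma scale_zero: "I \<subseteq> carrier R \<Longrightarrow> I \<noteq> {} \<Longrightarrow> \<zero> <#\<^bsub>R\<^esub> I = {\<zero>}"
  by (auto simp: mem_scale subset_iff)

lemma zero_submodule: "subring E R \<Longrightarrow> {\<zero>} \<in> submodules R E"
  by (rule submodulesI) (auto simp: subset_iff dest: subringE(1))

lemma carrier_submodule: "subring E R \<Longrightarrow> carrier R \<in> submodules R E"
  by (rule submodulesI) (auto dest: subringE(1))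

lemma inv_nonzero: "x \<in> carrier R \<Longrightarrow> x \<noteq> \<zero> \<Longrightarrow> inv x \<in> carrier R \<and> x \<otimes> inv x = \<one> \<and> inv x \<otimes> x = \<one> \<and> inv x \<noteq> \<zero>"
  using field_Units by (metis Diff_iff Units_inv_closed Units_l_inv Units_r_inv l_null singletonD singletonI one_not_zero)

section \<open>Extension of a submodule to an overring\<close>

lemma ext_least:
  assumes T: "subring T R" and N': "N' \<in> submodules R T" and "N \<subseteq> N'"
  shows "N \<cdot> T \<subseteq> N'"
proof
  fix z assume "z \<in> N \<cdot> T"
  then show "z \<in> N'"
  proof induct
    case (prod i j)
    then have "j \<otimes> i \<in> N'" "i \<in> carrier R" "j \<in> carrier R"
      using assms submodulesD[OF T N'] subringE(1)[OF T] by auto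
    then show ?case
      by (simp add: m_comm)
  qed (use submodulesD[OF T N'] in auto)
qed

lemma ext_submodule:
  assumes T: "subring T R" and "N \<subseteq> carrier R" "N \<noteq> {}"
  shows "N \<cdot> T \<in> submodules R T"
proof (rule submodulesI[OF T])
  show c: "N \<cdot> T \<subseteq> carrier R"
  proof
    fix z assume "z \<in> N \<cdot> T"
    then show "z \<in> carrier R"
      by induct (use assms subringE(1)[OF T] in auto)
  qed
  show "\<zero> \<in> N \<cdot> T"
  proof -
    obtain n where "n \<in> N" using assms by blast
    then have "n \<otimes> \<zero> \<in> N \<cdot> T"
      using ideal_prod.prod subringE(2)[OF T] by metis
    then show ?thesis
      using \<open>n \<in> N\<close> assms by auto
  qed
  show "x \<oplus> y \<in> N \<cdot> T" if "x \<in> N \<cdot> T" "y \<in> N \<cdot> T" for x y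
    using that by (rule ideal_prod.sum)
  show "e \<otimes> x \<in> N \<cdot> T" if e: "e \<in> T" and x: "x \<in> N \<cdot> T" for e x
    using x
  proof induct
    case (prod i j)
    then have "e \<otimes> (i \<otimes> j) = i \<otimes> (e \<otimes> j)"
      using assms e subringE(1)[OF T] by (simp add: m_lcomm subset_iff)
    then show ?case
      using prod e subringE(6)[OF T] by (simp add: ideal_prod.prod)
  next
    case (sum s1 s2)
    then show ?case
      using c e subringE(1)[OF T] by (simp add: r_distr subset_iff ideal_prod.sum)
  qed
qed

lemma ext_incl:
  assumes T: "subring T R" and "N \<subseteq> carrier R"
  shows "N \<subseteq> N \<cdot> T"
proof
  fix n assume "n \<in> N"
  then have "n \<otimes> \<one> \<in> N \<cdot> T"
    using subringE(3)[OF T] by (rule ideal_prod.prod)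
  then show "n \<in> N \<cdot> T"
    using \<open>n \<in> N\<close> assms(2) by auto
qed

lemma ext_mono:
  assumes "N \<subseteq> N'" "T \<subseteq> T'" shows "N \<cdot> T \<subseteq> N' \<cdot> T'"
proof
  fix z assume "z \<in> N \<cdot> T"
  then show "z \<in> N' \<cdot> T'"
    by induct (use assms in \<open>auto intro: ideal_prod.intros\<close>)
qed

lemma ext_id:
  assumes T: "subring T R" and "N \<in> submodules R T"
  shows "N \<cdot> T = N"
  using ext_least[OF T assms(2) order_refl] ext_incl[OF T submodulesD(1)[OF assms]] by blast

lemma ext_unital:
  assumes T: "subring T R" and N: "\<one> \<in> N" "N \<subseteq> T"
  shows "N \<cdot> T = T"
proof
  show "N \<cdot> T \<subseteq> T"
    using N by (intro ext_least subring_self_submodule T)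
  show "T \<subseteq> N \<cdot> T"
  proof
    fix t assume t: "t \<in> T"
    then have "\<one> \<otimes> t \<in> N \<cdot> T" using N by (intro ideal_prod.prod)
    then show "t \<in> N \<cdot> T" using t subringE(1)[OF T] by auto
  qed
qed

lemma ext_ext:
  assumes "subring E R" "subring T R" "E \<subseteq> T" "N \<subseteq> carrier R" "N \<noteq> {}"
  shows "(N \<cdot> E) \<cdot> T = N \<cdot> T"
proof
  have s: "N \<cdot> E \<in> submodules R E" "N \<cdot> T \<in> submodules R T"
    using assms ext_submodule by auto
  show "(N \<cdot> E) \<cdot> T \<subseteq> N \<cdot> T"
    by (intro ext_least assms s ext_mono order_refl)
  show "N \<cdot> T \<subseteq> (N \<cdot> E) \<cdot> T"
    by (intro ext_mono order_refl ext_incl assms)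
qed

lemma ext_comm:
  assumes "S \<subseteq> carrier R" "T \<subseteq> carrier R"
  shows "S \<cdot> T = T \<cdot> S"
proof -
  have "S \<cdot> T \<subseteq> T \<cdot> S" if "S \<subseteq> carrier R" "T \<subseteq> carrier R" for S T
  proof
    fix z assume "z \<in> S \<cdot> T"
    then show "z \<in> T \<cdot> S"
    proof induct
      case (prod i j)
      then have "i \<otimes> j = j \<otimes> i"
        using that by (auto intro: m_comm)
      then show ?case
        using prod ideal_prod.prod by metis
    qed (rule ideal_prod.sum)
  qed
  then show ?thesis
    using assms by blast
qed

lemma ext_scale:
  assumes T: "subring T R" and "N \<subseteq> carrier R" "N \<noteq> {}" and x: "x \<in> carrier R"
  shows "(x <#\<^bsub>R\<^esub> N) \<cdot> T = x <#\<^bsub>R\<^esub> (N \<cdot> T)"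
proof
  have NT: "N \<cdot> T \<in> submodules R T"
    using assms ext_submodule by auto
  have "x <#\<^bsub>R\<^esub> N \<subseteq> x <#\<^bsub>R\<^esub> (N \<cdot> T)"
    using ext_incl[OF T assms(2)] by (auto simp: l_coset_def)
  then show "(x <#\<^bsub>R\<^esub> N) \<cdot> T \<subseteq> x <#\<^bsub>R\<^esub> (N \<cdot> T)"
    by (intro ext_least T submodules_scale NT x)
  show "x <#\<^bsub>R\<^esub> (N \<cdot> T) \<subseteq> (x <#\<^bsub>R\<^esub> N) \<cdot> T"
  proof
    fix z assume "z \<in> x <#\<^bsub>R\<^esub> (N \<cdot> T)"
    then obtain u where u: "u \<in> N \<cdot> T" "z = x \<otimes> u"
      by (auto simp: mem_scale)
    from u(1) have "x \<otimes> u \<in> (x <#\<^bsub>R\<^esub> N) \<cdot> T"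
    proof induct
      case (prod i j)
      have "(x \<otimes> i) \<otimes> j \<in> (x <#\<^bsub>R\<^esub> N) \<cdot> T"
        using prod by (auto intro!: ideal_prod.prod simp: mem_scale)
      then show ?case
        using prod x assms(2) subringE(1)[OF T] by (simp add: m_assoc subset_iff)
    next
      case (sum s t)
      then show ?case
        using x submodulesD(1)[OF T NT] by (simp add: r_distr subset_iff ideal_prod.sum)
    qed
    then show "z \<in> (x <#\<^bsub>R\<^esub> N) \<cdot> T"
      using u by simp
  qed
qed

text \<open>An element is built from finitely many products, and \<open>Y\<close> collects their
  second factors; \<open>Y\<close> is a mere set, not a ring. This finiteness is what the
  compactness of \<Theta> is applied to later.\<close>

lemma ext_finite_support:
  assumes "z \<in> N \<cdot> T"
  shows "\<exists>Y. finite Y \<and> Y \<subseteq> T \<and> z \<in> N \<cdot> Y"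
  using assms
proof induct
  case (prod i j)
  then show ?case
    by (intro exI[of _ "{j}"]) (auto intro: ideal_prod.prod)
next
  case (sum s t)
  then obtain Y Z where "finite Y" "Y \<subseteq> T" "s \<in> N \<cdot> Y" "finite Z" "Z \<subseteq> T" "t \<in> N \<cdot> Z"
    by blast
  moreover from this have "s \<oplus> t \<in> N \<cdot> (Y \<union> Z)"
    using ext_mono[of N N Y "Y \<union> Z"] ext_mono[of N N Z "Y \<union> Z"] by (intro ideal_prod.sum) auto
  ultimately show ?case
    by (intro exI[of _ "Y \<union> Z"]) auto
qed

lemma colon_submodule:
  assumes E: "subring E R" and T: "subring T R" "E \<subseteq> T" and N: "N \<in> submodules R E" and z: "z \<in> carrier R"
  shows "{d \<in> T. d \<otimes> z \<in> N} \<in> submodules R E"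
proof (rule submodulesI[OF E])
  note D = submodulesD[OF E N] and c = subringE(1)[OF T(1)]
  show "{d \<in> T. d \<otimes> z \<in> N} \<subseteq> carrier R"
    using subringE[OF T(1)] by auto
  show "\<zero> \<in> {d \<in> T. d \<otimes> z \<in> N}"
    using subringE[OF T(1)] D z by auto
  show "x \<oplus> y \<in> {d \<in> T. d \<otimes> z \<in> N}" if "x \<in> {d \<in> T. d \<otimes> z \<in> N}" "y \<in> {d \<in> T. d \<otimes> z \<in> N}" for x y
    using that D(3) subringE(7)[OF T(1)] c z by (auto simp: l_distr subset_iff)
  show "e \<otimes> x \<in> {d \<in> T. d \<otimes> z \<in> N}" if "e \<in> E" "x \<in> {d \<in> T. d \<otimes> z \<in> N}" for e x
    using that D(4) subringE(6)[OF T(1)] T(2) c z by (auto simp: m_assoc subset_iff)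
qed

text \<open>Multiplying an expression of 1 as a sum of products \<open>c \<otimes> t\<close> by
  \<open>z\<close> puts \<open>z\<close> into the \<open>T\<close>-module \<open>W\<close>.
  Formally, the elements of \<open>T\<close> that carry \<open>z\<close> into \<open>W\<close> form
  a \<open>T\<close>-module containing \<open>C\<close>, hence 1.\<close>

lemma ext_colon_imp_mem:
  assumes E: "subring E R" and T: "subring T R" "E \<subseteq> T" and W: "W \<in> submodules R T" and z: "z \<in> carrier R"
    and C: "\<one> \<in> C \<cdot> T" "C \<subseteq> T" "\<And>c. c \<in> C \<Longrightarrow> c \<otimes> z \<in> W"
  shows "z \<in> W"
proof -
  have "C \<cdot> T \<subseteq> {d \<in> T. d \<otimes> z \<in> W}"
    using C by (intro ext_least colon_submodule T W z order_refl) auto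
  then show ?thesis
    using C(1) z by auto
qed


end


section \<open>Flat overrings\<close>

lemma subgroup_free_Abelian_group_iff:
  "subgroup H (free_Abelian_group A) \<longleftrightarrow> (\<forall>c\<in>H. Poly_Mapping.keys c \<subseteq> A) \<and> 0 \<in> H \<and>
     (\<forall>c\<in>H. \<forall>d\<in>H. c + d \<in> H) \<and> (\<forall>c\<in>H. - c \<in> H)" (is "?l \<longleftrightarrow> ?r")
proof
  assume ?l
  then interpret subgroup H "free_Abelian_group A" .
  show ?r
  proof (intro conjI ballI)
    show k: "Poly_Mapping.keys c \<subseteq> A" if "c \<in> H" for c
      using subset that by (auto simp: subset_iff)
    show "0 \<in> H" using one_closed by simp
    show "c + d \<in> H" if "c \<in> H" "d \<in> H" for c d
      using m_closed[OF that] by simp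
    show "- c \<in> H" if "c \<in> H" for c
      using m_inv_closed[OF that] k[OF that] by simp
  qed
next
  assume ?r
  then show ?l
    by (intro group.subgroupI) (auto simp: subset_iff)
qed

text \<open>The generators of \<open>tensor_relations\<close>, split off so that a subgroup is seen
  to contain all relations by checking the three bilinearity families.\<close>

definition tensor_relators ::
  "('a, 'b) ring_scheme \<Rightarrow> ('a, 'm, 'c) module_scheme \<Rightarrow> ('a, 'n, 'd) module_scheme
     \<Rightarrow> (('m \<times> 'n) \<Rightarrow>\<^sub>0 int) set" where
  "tensor_relators S M N =
     {frag_of (x \<oplus>\<^bsub>M\<^esub> x', y) - frag_of (x, y) - frag_of (x', y) |x x' y.
          x \<in> carrier M \<and> x' \<in> carrier M \<and> y \<in> carrier N}
    \<union> {frag_of (x, y \<oplus>\<^bsub>N\<^esub> y') - frag_of (x, y) - frag_of (x, y') |x y y'.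
          x \<in> carrier M \<and> y \<in> carrier N \<and> y' \<in> carrier N}
    \<union> {frag_of (r \<odot>\<^bsub>M\<^esub> x, y) - frag_of (x, r \<odot>\<^bsub>N\<^esub> y) |r x y.
          r \<in> carrier S \<and> x \<in> carrier M \<and> y \<in> carrier N}"

lemma keys_diff_subset: "Poly_Mapping.keys c \<subseteq> A \<Longrightarrow> Poly_Mapping.keys d \<subseteq> A \<Longrightarrow> Poly_Mapping.keys (c - d) \<subseteq> A"
  using keys_diff by fastforce

lemma tensor_relators_subset:
  assumes "module S M" "module S N"
  shows "tensor_relators S M N \<subseteq> carrier (free_Abelian_group (carrier M \<times> carrier N))"
proof -
  interpret M: module S M by fact
  interpret N: module S N by fact
  show ?thesis
  proof
    fix c assume "c \<in> tensor_relators S M N"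
    then show "c \<in> carrier (free_Abelian_group (carrier M \<times> carrier N))"
      unfolding tensor_relators_def
      by (elim UnE CollectE exE conjE) (simp_all add: keys_diff_subset)
  qed
qed

lemma subgroup_tensor_relations:
  assumes "module S M" "module S N"
  shows "subgroup (tensor_relations S M N) (free_Abelian_group (carrier M \<times> carrier N))"
    "tensor_relators S M N \<subseteq> tensor_relations S M N"
    "\<And>H. subgroup H (free_Abelian_group (carrier M \<times> carrier N)) \<Longrightarrow> tensor_relators S M N \<subseteq> H \<Longrightarrow>
       tensor_relations S M N \<subseteq> H"
proof -
  have eq: "tensor_relations S M N = generate (free_Abelian_group (carrier M \<times> carrier N)) (tensor_relators S M N)"
    by (simp add: tensor_relations_def tensor_relators_def)
  show "subgroup (tensor_relations S M N) (free_Abelian_group (carrier M \<times> carrier N))"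
    unfolding eq using tensor_relators_subset[OF assms] by (intro group.generate_is_subgroup) auto
  show "tensor_relators S M N \<subseteq> tensor_relations S M N"
    unfolding eq by (auto intro: generate.incl)
  show "tensor_relations S M N \<subseteq> H"
    if "subgroup H (free_Abelian_group (carrier M \<times> carrier N))" "tensor_relators S M N \<subseteq> H" for H
    unfolding eq using that by (intro group.generate_subgroup_incl) auto
qed


section \<open>Elementwise flatness and its consequences\<close>

context field
begin

text \<open>For an overring \<open>T\<close> of \<open>E\<close> inside the quotient field this is equivalent to flatness
  (Richman, Akiba); only the implication from flatness is needed.\<close>

definition eflat :: "'a set \<Rightarrow> 'a set \<Rightarrow> bool" where
  "eflat E T \<longleftrightarrow> subring E R \<and> subring T R \<and> E \<subseteq> T \<and> (\<forall>t\<in>T. \<one> \<in> {d \<in> E. d \<otimes> t \<in> E} \<cdot> T)"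

lemma eflatD: "eflat E T \<Longrightarrow> subring E R" "eflat E T \<Longrightarrow> subring T R" "eflat E T \<Longrightarrow> E \<subseteq> T"
  by (auto simp: eflat_def)

text \<open>A denominator of \<open>t\<close> in \<open>D\<close> is also one in \<open>E\<close>,
  so the ideal that has to generate \<open>T\<close> only grows.\<close>

lemma eflat_mono:
  assumes "eflat D T" "subring E R" "D \<subseteq> E" "E \<subseteq> T"
  shows "eflat E T"
  using assms ext_mono[of "{d \<in> D. d \<otimes> t \<in> D}" "{d \<in> E. d \<otimes> t \<in> E}" T T for t]
  unfolding eflat_def by blast

text \<open>Products of elements of \<open>C\<close> and \<open>C'\<close> lie in both. As
  \<open>C\<close> generates the unit ideal of \<open>T\<close>, each \<open>c'\<close> in
  \<open>C'\<close> lies in the extension of the intersection; then so does 1, which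
  \<open>C'\<close> generates.\<close>

lemma one_in_ext_Int:
  assumes E: "subring E R" and T: "subring T R" "E \<subseteq> T"
    and C: "C \<in> submodules R E" "C \<subseteq> E" "\<one> \<in> C \<cdot> T"
    and C': "C' \<in> submodules R E" "C' \<subseteq> E" "\<one> \<in> C' \<cdot> T"
  shows "\<one> \<in> (C \<inter> C') \<cdot> T"
proof -
  have sub: "C \<inter> C' \<in> submodules R E"
    using E C C' submodules_Int by blast
  have W: "(C \<inter> C') \<cdot> T \<in> submodules R T"
    using submodulesD[OF E sub] by (intro ext_submodule T) auto
  have "c' \<in> (C \<inter> C') \<cdot> T" if c': "c' \<in> C'" for c'
  proof (rule ext_colon_imp_mem[OF E T W _ C(3)])
    show "c' \<in> carrier R" "C \<subseteq> T"
      using c' C' C T subringE(1)[OF E] by auto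
    fix c assume c: "c \<in> C"
    have "c \<otimes> c' \<in> C'" "c' \<otimes> c \<in> C"
      using c c' submodulesD(4)[OF E C'(1)] submodulesD(4)[OF E C(1)] C(2) C'(2) by auto
    moreover have "c' \<otimes> c = c \<otimes> c'"
      using c c' C(2) C'(2) subringE(1)[OF E] by (intro m_comm) auto
    ultimately have "c \<otimes> c' \<in> C \<inter> C'"
      by simp
    then show "c \<otimes> c' \<in> (C \<inter> C') \<cdot> T"
      using ext_incl[OF T(1) submodulesD(1)[OF E sub]] by blast
  qed
  then have "C' \<cdot> T \<subseteq> (C \<inter> C') \<cdot> T"
    by (intro ext_least T W) auto
  then show ?thesis
    using C'(3) by auto
qed

text \<open>A denominator of \<open>j\<close> in \<open>E\<close> carries
  \<open>i \<otimes> j\<close> into \<open>N\<close> whenever \<open>i\<close> is in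
  \<open>N\<close>; for a sum the two colon ideals are intersected. The defining condition of
  \<open>eflat\<close> thus passes from \<open>E\<close> to every submodule.\<close>

lemma eflat_colon:
  assumes F: "eflat E T" and N: "N \<in> submodules R E" and z: "z \<in> N \<cdot> T"
  shows "\<one> \<in> {d \<in> E. d \<otimes> z \<in> N} \<cdot> T"
proof -
  note E = eflatD(1)[OF F] and T = eflatD(2,3)[OF F] and D = submodulesD[OF eflatD(1)[OF F] N]
  have NT: "N \<cdot> T \<subseteq> carrier R"
    using submodulesD(1)[OF T(1) ext_submodule[OF T(1) D(1)]] D(2) by blast
  show ?thesis
    using z
  proof induct
    case (prod i j)
    have "\<one> \<in> {d \<in> E. d \<otimes> j \<in> E} \<cdot> T"
      using prod F by (auto simp: eflat_def)
    moreover have "{d \<in> E. d \<otimes> j \<in> E} \<subseteq> {d \<in> E. d \<otimes> (i \<otimes> j) \<in> N}"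
    proof safe
      fix d assume d: "d \<in> E" "d \<otimes> j \<in> E"
      then have "(d \<otimes> j) \<otimes> i \<in> N"
        using D(4) prod by blast
      moreover have "(d \<otimes> j) \<otimes> i = d \<otimes> (i \<otimes> j)"
        using d prod D(1) subringE(1)[OF E] subringE(1)[OF T(1)] by (simp add: m_ac subset_iff)
      ultimately show "d \<otimes> (i \<otimes> j) \<in> N"
        by simp
    qed
    ultimately show ?case
      using ext_mono by blast
  next
    case (sum s t)
    have c: "s \<in> carrier R" "t \<in> carrier R"
      using sum NT by auto
    have "\<one> \<in> ({d \<in> E. d \<otimes> s \<in> N} \<inter> {d \<in> E. d \<otimes> t \<in> N}) \<cdot> T"
      by (rule one_in_ext_Int[OF E T]) (use sum c colon_submodule[OF E E order_refl N] in auto)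
    moreover have "{d \<in> E. d \<otimes> s \<in> N} \<inter> {d \<in> E. d \<otimes> t \<in> N} \<subseteq> {d \<in> E. d \<otimes> (s \<oplus> t) \<in> N}"
      using c subringE(1)[OF E] D(3) by (auto simp: r_distr subset_iff)
    ultimately show ?case
      using ext_mono by blast
  qed
qed

text \<open>For \<open>z\<close> in both extensions the colon ideals of \<open>z\<close> into
  \<open>N\<close> and \<open>N'\<close> generate the unit ideal of \<open>T\<close>. So does their
  intersection, whose elements carry \<open>z\<close> into \<open>N \<inter> N'\<close>.\<close>

lemma eflat_ext_Int:
  assumes F: "eflat E T" and N: "N \<in> submodules R E" and N': "N' \<in> submodules R E"
  shows "(N \<inter> N') \<cdot> T = N \<cdot> T \<inter> N' \<cdot> T"
proof
  note E = eflatD(1)[OF F] and T = eflatD(2,3)[OF F]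
  show "(N \<inter> N') \<cdot> T \<subseteq> N \<cdot> T \<inter> N' \<cdot> T"
    using ext_mono[of "N \<inter> N'" N T T] ext_mono[of "N \<inter> N'" N' T T] by auto
  note sub = submodules_Int[OF E N N']
  have W: "(N \<inter> N') \<cdot> T \<in> submodules R T"
    using submodulesD[OF E sub] by (intro ext_submodule T) auto
  show "N \<cdot> T \<inter> N' \<cdot> T \<subseteq> (N \<inter> N') \<cdot> T"
  proof
    fix z assume z: "z \<in> N \<cdot> T \<inter> N' \<cdot> T"
    have zc: "z \<in> carrier R"
      using z submodulesD[OF E N] submodulesD(1)[OF T(1) ext_submodule[OF T(1), of N]] by blast
    let ?C = "{d \<in> E. d \<otimes> z \<in> N}" and ?C' = "{d \<in> E. d \<otimes> z \<in> N'}"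
    have one: "\<one> \<in> (?C \<inter> ?C') \<cdot> T"
      by (rule one_in_ext_Int[OF E T])
        (use z F N N' eflat_colon colon_submodule[OF E E order_refl _ zc] in auto)
    show "z \<in> (N \<inter> N') \<cdot> T"
    proof (rule ext_colon_imp_mem[OF E T W zc one])
      show "?C \<inter> ?C' \<subseteq> T"
        using T(2) by auto
      fix c assume "c \<in> ?C \<inter> ?C'"
      then show "c \<otimes> z \<in> (N \<inter> N') \<cdot> T"
        using ext_incl[OF T(1) submodulesD(1)[OF E sub]] by blast
    qed
  qed
qed

text \<open>Submodules of the field are transported to the element type over which flatness is tested.\<close>

definition copy_module :: "'a set \<Rightarrow> ('a, (nat \<Rightarrow> 'a) set) module" where
  "copy_module I = \<lparr>carrier = (\<lambda>z. {\<lambda>_. z}) ` I, monoid.mult = (\<lambda>_ _. {}), one = {},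
     ring.zero = {\<lambda>_. \<zero>}, ring.add = (\<lambda>U Y. {\<lambda>n. the_elem U n \<oplus> the_elem Y n}),
     smult = (\<lambda>r U. {\<lambda>n. r \<otimes> the_elem U n})\<rparr>"

lemma copy_module_simps:
  "carrier (copy_module I) = (\<lambda>z. {\<lambda>_. z}) ` I"
  "{\<lambda>_. x} \<oplus>\<^bsub>copy_module I\<^esub> {\<lambda>_. y} = {\<lambda>_. x \<oplus> y}"
  "r \<odot>\<^bsub>copy_module I\<^esub> {\<lambda>_. x} = {\<lambda>_. r \<otimes> x}"
  "\<zero>\<^bsub>copy_module I\<^esub> = {\<lambda>_. \<zero>}"
  by (simp_all add: copy_module_def)

lemma module_copy_module:
  assumes E: "subring E R" and I: "I \<in> submodules R E"
  shows "module (R\<lparr>carrier := E\<rparr>) (copy_module I)"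
proof (rule moduleI)
  note D = submodulesD[OF E I] and c = subsetD[OF submodulesD(1)[OF E I]] and cE = subsetD[OF subringE(1)[OF E]]
  show "cring (R\<lparr>carrier := E\<rparr>)"
    using subcring_iff[OF subringE(1)[OF E]] subcringI'[OF E] by simp
  show "abelian_group (copy_module I)"
  proof (rule abelian_groupI)
    fix U assume "U \<in> carrier (copy_module I)"
    then obtain x where x: "x \<in> I" "U = {\<lambda>_. x}" by (auto simp: copy_module_simps)
    then show "\<exists>Y\<in>carrier (copy_module I). Y \<oplus>\<^bsub>copy_module I\<^esub> U = \<zero>\<^bsub>copy_module I\<^esub>"
      using submodules_neg[OF E I x(1)] c
      by (auto simp: copy_module_simps l_neg intro!: bexI[of _ "\<ominus> x"])
  qed (auto simp: copy_module_simps D(2,3) c a_ac)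
qed (auto simp: copy_module_simps submodulesD(4)[OF E I] subsetD[OF submodulesD(1)[OF E I]]
      subsetD[OF subringE(1)[OF E]] l_distr r_distr m_assoc)

text \<open>By flatness the inclusion of \<open>I\<close> in \<open>J\<close> stays injective after
  tensoring with \<open>N\<close>. The cosets of \<open>z\<close> and of 0 have the same image, so
  they agree: a relation between tensors from \<open>I\<close> that holds over \<open>J\<close>
  already holds over \<open>I\<close>.\<close>

lemma flat_module_inclusion:
  fixes I J :: "'a set"
  assumes E: "subring E R" and F: "flat_module (R\<lparr>carrier := E\<rparr>) N"
    and I: "I \<in> submodules R E" and J: "J \<in> submodules R E" "I \<subseteq> J"
    and z: "z \<in> tensor_relations (R\<lparr>carrier := E\<rparr>) (copy_module J) N"
      "Poly_Mapping.keys z \<subseteq> carrier (copy_module I) \<times> carrier N"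
  shows "z \<in> tensor_relations (R\<lparr>carrier := E\<rparr>) (copy_module I) N"
proof -
  let ?S = "R\<lparr>carrier := E\<rparr>"
  let ?M = "copy_module I" and ?M' = "copy_module J"
  let ?G = "free_Abelian_group (carrier ?M \<times> carrier N)" and ?G' = "free_Abelian_group (carrier ?M' \<times> carrier N)"
  let ?r = "tensor_relations ?S ?M N" and ?r' = "tensor_relations ?S ?M' N"
  have mods: "module ?S ?M" "module ?S ?M'" "module ?S N"
    using module_copy_module[OF E] I J F by (auto simp: flat_module_def)
  note r = subgroup_tensor_relations[OF mods(1,3)] and r' = subgroup_tensor_relations[OF mods(2,3)]
  note sr = r(1)[unfolded subgroup_free_Abelian_group_iff] and sr' = r'(1)[unfolded subgroup_free_Abelian_group_iff]
  have MM': "carrier ?M \<subseteq> carrier ?M'"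
    using J by (auto simp: copy_module_simps)
  have "tensor_relators ?S ?M N \<subseteq> tensor_relators ?S ?M' N"
  proof -
    have "ring.add ?M = ring.add ?M'" "smult ?M = smult ?M'"
      by (simp_all add: copy_module_def)
    then show ?thesis
      unfolding tensor_relators_def by (simp only:) (intro Un_mono Collect_mono; use MM' in blast)
  qed
  then have "tensor_relators ?S ?M N \<subseteq> ?r' \<inter> carrier ?G"
    using r'(2) tensor_relators_subset[OF mods(1,3)] by auto
  moreover have "subgroup (?r' \<inter> carrier ?G) ?G"
    unfolding subgroup_free_Abelian_group_iff
  proof (intro conjI ballI)
    show "0 \<in> ?r' \<inter> carrier ?G"
      using sr' by simp
    show "c + d \<in> ?r' \<inter> carrier ?G" if "c \<in> ?r' \<inter> carrier ?G" "d \<in> ?r' \<inter> carrier ?G" for c d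
      using that sr' order_trans[OF keys_add[of c d], of "carrier ?M \<times> carrier N"] by simp
    show "- c \<in> ?r' \<inter> carrier ?G" if "c \<in> ?r' \<inter> carrier ?G" for c
      using that sr' by simp
  qed simp
  ultimately have rr': "?r \<subseteq> ?r'"
    using r(3) by blast
  have id: "id \<in> module_hom ?S ?M ?M'" "inj_on id (carrier ?M)"
    using MM' by (auto simp: module_hom_def hom_def copy_module_def)
  have inj: "inj_on (tensor_map ?S ?M' N id) (carrier (tensor_product ?S ?M N))"
    using F mods(1,2) id unfolding flat_module_def by blast
  have cos: "?r #>\<^bsub>?G\<^esub> w \<in> carrier (tensor_product ?S ?M N)" if "w \<in> carrier ?G" for w
    using that by (auto simp: tensor_product_def FactGroup_def RCOSETS_def)
  \<comment> \<open>The value of \<open>tensor_map\<close> is a union of cosets over all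
    representatives. Every representative lies in \<open>?r'\<close> and so contributes
    \<open>?r'\<close> itself; the union equals \<open>?r'\<close> because there is at least one
    representative.\<close>
  have tm: "tensor_map ?S ?M' N id (?r #>\<^bsub>?G\<^esub> w) = ?r'" if w: "w \<in> ?r'" for w
  proof -
    have "?r' #>\<^bsub>?G'\<^esub> frag_extend (\<lambda>(x, y). frag_of (id x, y)) c = ?r'" if "c \<in> ?r #>\<^bsub>?G\<^esub> w" for c
    proof -
      have c: "c \<in> ?r'"
        using that rr' w sr' by (auto simp: r_coset_def)
      have eq: "(\<lambda>(x, y). frag_of (id x, y)) = (frag_of :: ((nat \<Rightarrow> 'a) set \<times> _) \<Rightarrow> _)"
        by auto
      have "frag_extend (\<lambda>(x, y). frag_of (id x, y)) c = c"
        unfolding eq by (rule frag_expansion[symmetric])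
      then show ?thesis
        using group.coset_join2[OF group_free_Abelian_group _ r'(1) c] c sr' by auto
    qed
    moreover have "?r #>\<^bsub>?G\<^esub> w \<noteq> {}"
      using sr by (auto simp: r_coset_def)
    ultimately show ?thesis
      by (simp add: tensor_map_def)
  qed
  have "?r #>\<^bsub>?G\<^esub> z = ?r #>\<^bsub>?G\<^esub> 0"
    using inj_onD[OF inj _ cos cos] tm z sr' by auto
  moreover have "z \<in> ?r #>\<^bsub>?G\<^esub> z" "?r #>\<^bsub>?G\<^esub> 0 = ?r"
    using sr by (auto simp: r_coset_def)
  ultimately show ?thesis
    by simp
qed

text \<open>Apply flatness to \<open>E + Et \<subseteq> K\<close> and the element \<open>t \<otimes> 1 - 1 \<otimes> t\<close>, which vanishes in \<open>K \<otimes> T\<close>. The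
  coefficient of \<open>t\<close> in an element of \<open>E + Et\<close> is well defined modulo \<open>(E : t)\<close>, so it induces a
  map from \<open>(E + Et) \<otimes> T\<close> to \<open>T/(E : t)T\<close> sending that element to the class of \<open>1\<close>.\<close>

lemma flat_overring_imp_eflat:
  assumes qf: "quotient_field R E" and F: "flat_overring R E T"
  shows "eflat E T"
  unfolding eflat_def
proof (intro conjI ballI)
  have FM: "flat_module (R\<lparr>carrier := E\<rparr>) (as_module R T)"
    using F by (simp add: flat_overring_def)
  show E: "subring E R"
    using qf by (auto simp: quotient_field_def subdomain_def subcring_def)
  show T: "subring T R" "E \<subseteq> T"
    using F by (auto simp: flat_overring_def overrings_def)
  fix t assume t: "t \<in> T"
  note cT = subsetD[OF subringE(1)[OF T(1)]] and cE = subsetD[OF subringE(1)[OF E]]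
  have tc: "t \<in> carrier R" using t cT by auto
  define C where "C = {d \<in> E. d \<otimes> t \<in> E}"
  have Cs: "C \<in> submodules R E"
    unfolding C_def by (rule colon_submodule[OF E E order_refl subring_self_submodule[OF E] tc])
  have CT: "C \<cdot> T \<in> submodules R T"
    using submodulesD[OF E Cs] by (intro ext_submodule T) auto
  note W = submodulesD[OF T(1) CT] and Wneg = submodules_neg[OF T(1) CT]
  have inC: "c \<otimes> y \<in> C \<cdot> T" if "c \<in> E" "c \<otimes> t \<in> E" "y \<in> T" for c y
    using that by (intro ideal_prod.prod) (auto simp: C_def)
  note Eadd = subringE(7)[OF E] and Eneg = subringE(5)[OF E] and Emult = subringE(6)[OF E]
  have Eminus: "x \<ominus> y \<in> E" if "x \<in> E" "y \<in> E" for x y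
    using that Eadd Eneg by (simp add: a_minus_def)
  \<comment> \<open>This is E + Et, described by the existence of a coefficient of \<open>t\<close>
    modulo \<open>E\<close>.\<close>
  define I where "I = {w \<in> carrier R. \<exists>c\<in>E. w \<ominus> c \<otimes> t \<in> E}"
  have I: "I \<in> submodules R E"
  proof (rule submodulesI[OF E])
    show "I \<subseteq> carrier R" by (auto simp: I_def)
    have "\<zero> \<ominus> \<zero> \<otimes> t = \<zero>" using tc by (simp add: a_minus_def)
    then show "\<zero> \<in> I" using subringE(2)[OF E] by (force simp: I_def)
    show "x \<oplus> y \<in> I" if xy: "x \<in> I" "y \<in> I" for x y
    proof -
      obtain c d where cd: "c \<in> E" "x \<ominus> c \<otimes> t \<in> E" "d \<in> E" "y \<ominus> d \<otimes> t \<in> E" "x \<in> carrier R" "y \<in> carrier R"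
        using xy by (auto simp: I_def)
      then have "(x \<oplus> y) \<ominus> (c \<oplus> d) \<otimes> t = (x \<ominus> c \<otimes> t) \<oplus> (y \<ominus> d \<otimes> t)"
        using tc cE[OF cd(1)] cE[OF cd(3)] by algebra
      then show ?thesis
        using cd Eadd by (auto simp: I_def intro!: bexI[of _ "c \<oplus> d"])
    qed
    show "e \<otimes> x \<in> I" if ex: "e \<in> E" "x \<in> I" for e x
    proof -
      obtain c where cd: "c \<in> E" "x \<ominus> c \<otimes> t \<in> E" "x \<in> carrier R"
        using ex by (auto simp: I_def)
      then have "(e \<otimes> x) \<ominus> (e \<otimes> c) \<otimes> t = e \<otimes> (x \<ominus> c \<otimes> t)"
        using tc cE[OF cd(1)] cE[OF ex(1)] by algebra
      then show ?thesis
        using cd cE[OF ex(1)] Emult ex by (auto simp: I_def intro!: bexI[of _ "e \<otimes> c"])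
    qed
  qed
  note cI = subsetD[OF submodulesD(1)[OF E I]]
  \<comment> \<open>An arbitrary choice of the coefficient of \<open>t\<close>. It is unique only
    modulo \<open>C\<close>, so \<phi> need not be linear; its defects will be shown to lie in
    \<open>C\<close>.\<close>
  define \<phi> where "\<phi> w = (SOME c. c \<in> E \<and> w \<ominus> c \<otimes> t \<in> E)" for w
  have \<phi>: "\<phi> w \<in> E" "w \<ominus> \<phi> w \<otimes> t \<in> E" if "w \<in> I" for w
    using that someI_ex[of "\<lambda>c. c \<in> E \<and> w \<ominus> c \<otimes> t \<in> E"] by (auto simp: I_def \<phi>_def)
  have "t \<ominus> \<one> \<otimes> t \<in> E" "\<one> \<ominus> \<zero> \<otimes> t \<in> E"
    using tc subringE(2,3)[OF E] by (simp_all add: a_minus_def r_neg)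
  then have tI: "t \<in> I" "\<one> \<in> I"
    unfolding I_def using tc subringE(2,3)[OF E] by blast+
  let ?S = "R\<lparr>carrier := E\<rparr>" and ?N = "as_module R T" and ?h = "\<lambda>z::'a. {\<lambda>_::nat. z}"
  let ?M = "copy_module I" and ?K = "copy_module (carrier R)"
  have N: "carrier ?N = T" "\<And>x y. x \<oplus>\<^bsub>?N\<^esub> y = x \<oplus> y" "\<And>x y. x \<odot>\<^bsub>?N\<^esub> y = x \<otimes> y"
    by (simp_all add: as_module_def)
  have mods: "module ?S ?M" "module ?S ?K" "module ?S ?N"
    using module_copy_module[OF E] I carrier_submodule[OF E] FM by (auto simp: flat_module_def)
  define z where "z = frag_of (?h t, \<one>) - frag_of (?h \<one>, t)"
  \<comment> \<open>With t = a/b, both tensors become that of 1/b and \<open>a\<close>, once by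
    moving \<open>a\<close> across and once by moving \<open>b\<close> across.\<close>
  have "z \<in> tensor_relations ?S ?K ?N"
  proof -
    obtain a b where ab: "a \<in> E" "b \<in> E - {\<zero>}" "t = a \<otimes> inv b"
      using qf tc unfolding quotient_field_def by meson
    then have c: "a \<in> carrier R" "b \<in> carrier R" "b \<noteq> \<zero>" using cE by auto
    note i = inv_nonzero[OF c(2,3)]
    have bt: "b \<otimes> t = a" using ab i c by (simp add: m_lcomm)
    let ?u = "frag_of (?h t, \<one>) - frag_of (?h (inv b), a)" and ?v = "frag_of (?h \<one>, t) - frag_of (?h (inv b), a)"
    have "?u \<in> tensor_relators ?S ?K ?N"
      unfolding tensor_relators_def
      by (intro UnI2 CollectI exI[of _ a] exI[of _ "?h (inv b)"] exI[of _ \<one>])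
        (use ab i c subringE(3)[OF T(1)] in \<open>simp add: copy_module_simps N\<close>)
    moreover have "?v \<in> tensor_relators ?S ?K ?N"
      unfolding tensor_relators_def
      by (intro UnI2 CollectI exI[of _ b] exI[of _ "?h (inv b)"] exI[of _ t])
        (use ab i c bt t in \<open>simp add: copy_module_simps N\<close>)
    ultimately have uv: "?u \<in> tensor_relations ?S ?K ?N" "?v \<in> tensor_relations ?S ?K ?N"
      using subgroup_tensor_relations(2)[OF mods(2,3)] by auto
    have "?u + - ?v \<in> tensor_relations ?S ?K ?N"
      using uv subgroup_tensor_relations(1)[OF mods(2,3)] unfolding subgroup_free_Abelian_group_iff by blast
    then show ?thesis by (simp add: z_def)
  qed
  moreover have "Poly_Mapping.keys z \<subseteq> carrier ?M \<times> carrier ?N"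
    unfolding z_def using tI t subringE(3)[OF T(1)]
    by (intro keys_diff_subset) (auto simp: copy_module_simps N)
  ultimately have zr: "z \<in> tensor_relations ?S ?M ?N"
    by (rule flat_module_inclusion[OF E FM I carrier_submodule[OF E] submodulesD(1)[OF E I]])
  let ?G = "free_Abelian_group (carrier ?M \<times> carrier ?N)"
  define f where "f p = \<phi> (the_elem (fst p) 0) \<otimes> snd p" for p :: "(nat \<Rightarrow> 'a) set \<times> 'a"
  have f: "f (?h x, y) = \<phi> x \<otimes> y" for x y
    by (simp add: f_def)
  have "f ` (carrier ?M \<times> carrier ?N) \<subseteq> carrier (add_monoid R)"
    using \<phi>(1) cE cT by (auto simp: f copy_module_simps N)
  then obtain g where g: "g \<in> hom ?G (add_monoid R)" "\<And>p. p \<in> carrier ?M \<times> carrier ?N \<Longrightarrow> g (frag_of p) = f p"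
    using comm_group.free_Abelian_group_universal[OF a_comm_group] by metis
  interpret g: group_hom ?G "add_monoid R" g
    using g(1) by (intro group_hom.intro group_hom_axioms.intro) (auto simp: add.group_axioms)
  have gc: "g c \<in> carrier R" if "Poly_Mapping.keys c \<subseteq> carrier ?M \<times> carrier ?N" for c
    using g.hom_closed[of c] that by simp
  have gadd: "g (c + d) = g c \<oplus> g d"
    if "Poly_Mapping.keys c \<subseteq> carrier ?M \<times> carrier ?N" "Poly_Mapping.keys d \<subseteq> carrier ?M \<times> carrier ?N" for c d
    using g.hom_mult[of c d] that by simp
  have gneg: "g (- c) = \<ominus> g c" if "Poly_Mapping.keys c \<subseteq> carrier ?M \<times> carrier ?N" for c
    using g.hom_inv[of c] that by (simp add: a_inv_def)
  have gminus: "g (c - d) = g c \<ominus> g d"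
    if "Poly_Mapping.keys c \<subseteq> carrier ?M \<times> carrier ?N" "Poly_Mapping.keys d \<subseteq> carrier ?M \<times> carrier ?N" for c d
    using gadd[of c "- d"] gneg[of d] that by (simp add: a_minus_def)
  have gf: "g (frag_of (?h x, y)) = \<phi> x \<otimes> y" "Poly_Mapping.keys (frag_of (?h x, y)) \<subseteq> carrier ?M \<times> carrier ?N"
    if "x \<in> I" "y \<in> T" for x y
    using that by (auto simp: g(2) f copy_module_simps N)
  \<comment> \<open>The preimage of \<open>C \<cdot> T\<close> under \<open>g\<close>. Being a
    subgroup, it contains every relation, and in particular \<open>z\<close>, once it contains the
    relators.\<close>
  let ?H = "{c. Poly_Mapping.keys c \<subseteq> carrier ?M \<times> carrier ?N \<and> g c \<in> C \<cdot> T}"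
  have "subgroup ?H ?G"
    unfolding subgroup_free_Abelian_group_iff
  proof (intro conjI ballI)
    show "0 \<in> ?H" using W(2) g.hom_one by simp
    show "c + d \<in> ?H" if "c \<in> ?H" "d \<in> ?H" for c d
      using that gadd[of c d] W(3)[of "g c" "g d"] order_trans[OF keys_add[of c d], of "carrier ?M \<times> carrier ?N"] by simp
    show "- c \<in> ?H" if "c \<in> ?H" for c
      using that gneg[of c] Wneg[of "g c"] by simp
  qed simp
  moreover have "tensor_relators ?S ?M ?N \<subseteq> ?H"
  proof
    fix c assume c: "c \<in> tensor_relators ?S ?M ?N"
    have k: "Poly_Mapping.keys c \<subseteq> carrier ?M \<times> carrier ?N"
      using subsetD[OF tensor_relators_subset[OF mods(1,3)] c] by simp
    have "g c \<in> C \<cdot> T"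
      using c unfolding tensor_relators_def
    proof (elim UnE CollectE exE conjE)
      fix U U' y assume a: "c = frag_of (U \<oplus>\<^bsub>?M\<^esub> U', y) - frag_of (U, y) - frag_of (U', y)"
        "U \<in> carrier ?M" "U' \<in> carrier ?M" "y \<in> carrier ?N"
      then obtain x x' where x: "x \<in> I" "x' \<in> I" "U = ?h x" "U' = ?h x'" by (auto simp: copy_module_simps)
      have y: "y \<in> T" using a N by simp
      have xx: "x \<oplus> x' \<in> I" using x submodulesD(3)[OF E I] by blast
      let ?p = "\<phi> (x \<oplus> x')" and ?q = "\<phi> x" and ?r = "\<phi> x'"
      have ca: "?p \<in> carrier R" "?q \<in> carrier R" "?r \<in> carrier R" "x \<in> carrier R" "x' \<in> carrier R" "y \<in> carrier R"
        using \<phi>(1) x xx cE cI cT y by auto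
      have "c = frag_of (?h (x \<oplus> x'), y) - frag_of (?h x, y) - frag_of (?h x', y)"
        using a x by (simp add: copy_module_simps)
      then have "g c = ?p \<otimes> y \<ominus> ?q \<otimes> y \<ominus> ?r \<otimes> y"
        using gf[OF xx y] gf[OF x(1) y] gf[OF x(2) y] by (simp add: gminus keys_diff_subset)
      also have "\<dots> = (?p \<ominus> ?q \<ominus> ?r) \<otimes> y"
        using ca by algebra
      also have "\<dots> \<in> C \<cdot> T"
      proof (rule inC[OF _ _ y])
        show "?p \<ominus> ?q \<ominus> ?r \<in> E" using \<phi>(1) x xx Eminus by simp
        \<comment> \<open>Multiplied by \<open>t\<close>, the additivity defect of \<phi> becomes a
          combination of remainders in \<open>E\<close>, so the defect lies in
          \<open>C\<close>.\<close>
        have "(?p \<ominus> ?q \<ominus> ?r) \<otimes> t = ((x \<ominus> ?q \<otimes> t) \<oplus> (x' \<ominus> ?r \<otimes> t)) \<ominus> ((x \<oplus> x') \<ominus> ?p \<otimes> t)"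
          using ca tc by algebra
        also have "\<dots> \<in> E" using \<phi>(2) x xx Eadd Eminus by simp
        finally show "(?p \<ominus> ?q \<ominus> ?r) \<otimes> t \<in> E" .
      qed
      finally show ?thesis .
    next
      fix U y y' assume a: "c = frag_of (U, y \<oplus>\<^bsub>?N\<^esub> y') - frag_of (U, y) - frag_of (U, y')"
        "U \<in> carrier ?M" "y \<in> carrier ?N" "y' \<in> carrier ?N"
      then obtain x where x: "x \<in> I" "U = ?h x" by (auto simp: copy_module_simps)
      have y: "y \<in> T" "y' \<in> T" "y \<oplus> y' \<in> T" using a N subringE(7)[OF T(1)] by auto
      have "g c = \<phi> x \<otimes> (y \<oplus> y') \<ominus> \<phi> x \<otimes> y \<ominus> \<phi> x \<otimes> y'"
        using a x gf[OF x(1) y(1)] gf[OF x(1) y(2)] gf[OF x(1) y(3)] N by (simp add: gminus keys_diff_subset)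
      also have "\<dots> = \<zero>"
        using \<phi>(1)[OF x(1)] cE cT y by algebra
      finally show ?thesis using W(2) by simp
    next
      fix r U y assume a: "c = frag_of (r \<odot>\<^bsub>?M\<^esub> U, y) - frag_of (U, r \<odot>\<^bsub>?N\<^esub> y)"
        "r \<in> carrier ?S" "U \<in> carrier ?M" "y \<in> carrier ?N"
      then obtain x where x: "x \<in> I" "U = ?h x" by (auto simp: copy_module_simps)
      have r: "r \<in> E" and y: "y \<in> T" "r \<otimes> y \<in> T" using a N T subringE(6)[OF T(1)] by auto
      have rx: "r \<otimes> x \<in> I" using r x submodulesD(4)[OF E I] by blast
      let ?p = "\<phi> (r \<otimes> x)" and ?q = "\<phi> x"
      have ca: "?p \<in> carrier R" "?q \<in> carrier R" "r \<in> carrier R" "x \<in> carrier R" "y \<in> carrier R"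
        using \<phi>(1) x rx cE cI cT y r by auto
      have "g c = ?p \<otimes> y \<ominus> ?q \<otimes> (r \<otimes> y)"
        using a x gf[OF rx y(1)] gf[OF x(1) y(2)] N by (simp add: gminus copy_module_simps)
      also have "\<dots> = (?p \<ominus> r \<otimes> ?q) \<otimes> y"
        using ca by algebra
      also have "\<dots> \<in> C \<cdot> T"
      proof (rule inC[OF _ _ y(1)])
        show "?p \<ominus> r \<otimes> ?q \<in> E" using \<phi>(1) x rx r Eminus Emult by simp
        have "(?p \<ominus> r \<otimes> ?q) \<otimes> t = r \<otimes> (x \<ominus> ?q \<otimes> t) \<ominus> (r \<otimes> x \<ominus> ?p \<otimes> t)"
          using ca tc by algebra
        also have "\<dots> \<in> E" using \<phi>(2) x rx r Emult Eminus by simp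
        finally show "(?p \<ominus> r \<otimes> ?q) \<otimes> t \<in> E" .
      qed
      finally show ?thesis .
    qed
    then show "c \<in> ?H" using k by simp
  qed
  ultimately have "z \<in> ?H"
    using subgroup_tensor_relations(3)[OF mods(1,3)] zr by blast
  then have gz: "\<phi> t \<otimes> \<one> \<ominus> \<phi> \<one> \<otimes> t \<in> C \<cdot> T"
    using gf[OF tI(1) subringE(3)[OF T(1)]] gf[OF tI(2) t] by (simp add: z_def gminus)
  have ca: "\<phi> t \<in> carrier R" "\<phi> \<one> \<in> carrier R"
    using \<phi>(1) tI cE by auto
  \<comment> \<open>Modulo \<open>C\<close>, the coefficient \<open>\<phi> t\<close> is 1 and
    \<open>\<phi> \<one>\<close> is 0. Hence \<open>g z\<close> is congruent to 1 modulo
    \<open>C \<cdot> T\<close>, and since it also lies there, so does 1.\<close>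
  have "(\<one> \<ominus> \<phi> t) \<otimes> \<one> \<in> C \<cdot> T"
  proof (rule inC)
    have "(\<one> \<ominus> \<phi> t) \<otimes> t = t \<ominus> \<phi> t \<otimes> t" using ca tc by algebra
    then show "(\<one> \<ominus> \<phi> t) \<otimes> t \<in> E" using \<phi>(2)[OF tI(1)] by simp
  qed (use \<phi>(1)[OF tI(1)] Eminus subringE(3)[OF E] subringE(3)[OF T(1)] in auto)
  moreover have "\<phi> \<one> \<otimes> t \<in> C \<cdot> T"
  proof (rule inC[OF _ _ t])
    have "\<phi> \<one> \<otimes> t = \<one> \<ominus> (\<one> \<ominus> \<phi> \<one> \<otimes> t)" using ca tc by algebra
    then show "\<phi> \<one> \<otimes> t \<in> E" using \<phi>(2)[OF tI(2)] Eminus subringE(3)[OF E] by metis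
  qed (use \<phi>(1)[OF tI(2)] in auto)
  ultimately have "(\<one> \<ominus> \<phi> t) \<otimes> \<one> \<oplus> (\<phi> t \<otimes> \<one> \<ominus> \<phi> \<one> \<otimes> t) \<oplus> \<phi> \<one> \<otimes> t \<in> C \<cdot> T"
    using gz W(3) by blast
  moreover have "(\<one> \<ominus> \<phi> t) \<otimes> \<one> \<oplus> (\<phi> t \<otimes> \<one> \<ominus> \<phi> \<one> \<otimes> t) \<oplus> \<phi> \<one> \<otimes> t = \<one>"
    using ca tc by algebra
  ultimately show "\<one> \<in> {d \<in> E. d \<otimes> t \<in> E} \<cdot> T"
    by (simp add: C_def)
qed


section \<open>Primes of overrings\<close>

lemma ideal_overring_iff:
  assumes E: "subring E R"
  shows "ideal I (R\<lparr>carrier := E\<rparr>) \<longleftrightarrow> I \<in> submodules R E \<and> I \<subseteq> E"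
proof
  assume I: "ideal I (R\<lparr>carrier := E\<rparr>)"
  have "I \<subseteq> E"
    using ideal.Icarr[OF I] by auto
  moreover have "x \<oplus> y \<in> I" if "x \<in> I" "y \<in> I" for x y
    using additive_subgroup.a_closed[OF ideal.axioms(1)[OF I] that] by simp
  moreover have "\<zero> \<in> I"
    using additive_subgroup.zero_closed[OF ideal.axioms(1)[OF I]] by simp
  ultimately show "I \<in> submodules R E \<and> I \<subseteq> E"
    using ideal.I_l_closed[OF I] subringE(1)[OF E] by (auto intro!: submodulesI[OF E])
next
  assume I: "I \<in> submodules R E \<and> I \<subseteq> E"
  note D = submodulesD[OF E conjunct1[OF I]]
  have sub: "subgroup I (add_monoid R)"
    using D submodules_neg[OF E conjunct1[OF I]] by (intro add.subgroupI) (auto simp: a_inv_def)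
  show "ideal I (R\<lparr>carrier := E\<rparr>)"
  proof (rule idealI[OF subring_is_ring[OF E]])
    show "subgroup I (add_monoid (R\<lparr>carrier := E\<rparr>))"
      using add.subgroup_incl[OF sub subring.axioms(1)[OF E]] I by simp
    show "x \<otimes>\<^bsub>R\<lparr>carrier := E\<rparr>\<^esub> a \<in> I" if "a \<in> I" "x \<in> carrier (R\<lparr>carrier := E\<rparr>)" for a x
      using that D(4) by simp
    then show "a \<otimes>\<^bsub>R\<lparr>carrier := E\<rparr>\<^esub> x \<in> I" if "a \<in> I" "x \<in> carrier (R\<lparr>carrier := E\<rparr>)" for a x
      using that D(1) subringE(1)[OF E] m_comm[of a x] by (simp add: subset_iff)
  qed
qed

lemma primeideal_overring_iff:
  assumes E: "subring E R"
  shows "primeideal P (R\<lparr>carrier := E\<rparr>) \<longleftrightarrow> P \<in> submodules R E \<and> P \<subseteq> E \<and> \<one> \<notin> P \<and>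
    (\<forall>a\<in>E. \<forall>b\<in>E. a \<otimes> b \<in> P \<longrightarrow> a \<in> P \<or> b \<in> P)"
proof
  assume P: "primeideal P (R\<lparr>carrier := E\<rparr>)"
  note I = primeideal.axioms(1)[OF P]
  have "\<one> \<notin> P"
    using primeideal.I_notcarr[OF P] ideal.one_imp_carrier[OF I] by auto
  then show "P \<in> submodules R E \<and> P \<subseteq> E \<and> \<one> \<notin> P \<and> (\<forall>a\<in>E. \<forall>b\<in>E. a \<otimes> b \<in> P \<longrightarrow> a \<in> P \<or> b \<in> P)"
    using primeideal.I_prime[OF P] I ideal_overring_iff[OF E] by auto
next
  assume P: "P \<in> submodules R E \<and> P \<subseteq> E \<and> \<one> \<notin> P \<and> (\<forall>a\<in>E. \<forall>b\<in>E. a \<otimes> b \<in> P \<longrightarrow> a \<in> P \<or> b \<in> P)"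
  have "cring (R\<lparr>carrier := E\<rparr>)"
    using subcring_iff[OF subringE(1)[OF E]] subcringI'[OF E] by simp
  then show "primeideal P (R\<lparr>carrier := E\<rparr>)"
    using P ideal_overring_iff[OF E] subringE(3)[OF E] by (intro primeidealI) auto
qed

lemma contracted_prime:
  assumes E: "subring E R" and T: "subring T R" "E \<subseteq> T" and Q: "primeideal Q (R\<lparr>carrier := T\<rparr>)"
  shows "primeideal (Q \<inter> E) (R\<lparr>carrier := E\<rparr>)"
proof -
  have "Q \<inter> E \<in> submodules R E"
    using Q submodules_antimono[OF E T] submodules_Int[OF E _ subring_self_submodule[OF E]]
    by (auto simp: primeideal_overring_iff[OF T(1)])
  then show ?thesis
    using Q T(2) by (auto simp: primeideal_overring_iff[OF T(1)] primeideal_overring_iff[OF E])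
qed

text \<open>Zorn gives \<open>M\<close> maximal among the ideals containing \<open>C\<close> but not
  1. If \<open>a \<otimes> b\<close> is in \<open>M\<close> and \<open>b\<close> is not, the colon
  ideal of \<open>b\<close> into \<open>M\<close> contains \<open>M\<close> and omits 1, so it
  equals \<open>M\<close>; and it contains \<open>a\<close>.\<close>

lemma exists_prime_above:
  assumes E: "subring E R" and C: "C \<in> submodules R E" "C \<subseteq> E" "\<one> \<notin> C"
  shows "\<exists>P. primeideal P (R\<lparr>carrier := E\<rparr>) \<and> C \<subseteq> P"
proof -
  let ?A = "{I \<in> submodules R E. C \<subseteq> I \<and> I \<subseteq> E \<and> \<one> \<notin> I}"
  have "\<exists>M\<in>?A. \<forall>I\<in>?A. M \<subseteq> I \<longrightarrow> I = M"
  proof (rule subset_Zorn_nonempty)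
    show "?A \<noteq> {}"
      using C by auto
    fix \<C> assume ne: "\<C> \<noteq> {}" and ch: "subset.chain ?A \<C>"
    have A: "I \<in> submodules R E" "C \<subseteq> I" "I \<subseteq> E" "\<one> \<notin> I" if "I \<in> \<C>" for I
      using ch that by (auto simp: subset.chain_def)
    have "\<Union>\<C> \<in> submodules R E"
    proof (rule submodulesI[OF E])
      show "\<Union>\<C> \<subseteq> carrier R" "\<zero> \<in> \<Union>\<C>"
        using A(1) ne submodulesD[OF E] by blast+
      show "e \<otimes> x \<in> \<Union>\<C>" if "e \<in> E" "x \<in> \<Union>\<C>" for e x
        using A(1) that submodulesD(4)[OF E] by blast
      show "x \<oplus> y \<in> \<Union>\<C>" if xy: "x \<in> \<Union>\<C>" "y \<in> \<Union>\<C>" for x y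
      proof -
        obtain I J where IJ: "x \<in> I" "I \<in> \<C>" "y \<in> J" "J \<in> \<C>"
          using xy by blast
        then have "I \<subseteq> J \<or> J \<subseteq> I"
          using ch unfolding subset_chain_def by blast
        then obtain L where "L \<in> \<C>" "x \<in> L" "y \<in> L"
          using IJ by blast
        then show ?thesis
          using A(1) submodulesD(3)[OF E] by blast
      qed
    qed
    then show "\<Union>\<C> \<in> ?A"
      using A ne by blast
  qed
  then obtain M where M: "M \<in> submodules R E" "C \<subseteq> M" "M \<subseteq> E" "\<one> \<notin> M"
    and max: "\<And>I. I \<in> submodules R E \<Longrightarrow> C \<subseteq> I \<Longrightarrow> I \<subseteq> E \<Longrightarrow> \<one> \<notin> I \<Longrightarrow> M \<subseteq> I \<Longrightarrow> I = M"
    by auto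
  have "a \<in> M" if ab: "a \<in> E" "b \<in> E" "a \<otimes> b \<in> M" "b \<notin> M" for a b
  proof -
    let ?I = "{x \<in> E. x \<otimes> b \<in> M}"
    have b: "b \<in> carrier R"
      using ab subringE(1)[OF E] by auto
    have "M \<subseteq> ?I"
    proof safe
      fix x assume x: "x \<in> M"
      then show "x \<in> E" using M by auto
      show "x \<otimes> b \<in> M"
        using submodulesD(4)[OF E M(1) ab(2) x] submodulesD(1)[OF E M(1)] x b m_comm[of b x] by auto
    qed
    then have "?I = M"
      using M b ab colon_submodule[OF E E order_refl M(1) b] by (intro max) auto
    then show ?thesis
      using ab by blast
  qed
  then show ?thesis
    using M primeideal_overring_iff[OF E] by blast
qed

section \<open>Primes surviving in a flat overring\<close>

lemma eflat_denominator:
  assumes F: "eflat E T" and P: "primeideal P (R\<lparr>carrier := E\<rparr>)" "\<one> \<notin> P \<cdot> T" and t: "t \<in> T"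
  shows "\<exists>s\<in>E - P. s \<otimes> t \<in> E"
proof (rule ccontr)
  assume "\<not> ?thesis"
  \<comment> \<open>If all denominators of \<open>t\<close> lay in \<open>P\<close>, flatness would
    put 1 into \<open>P \<cdot> T\<close>.\<close>
  then have "{d \<in> E. d \<otimes> t \<in> E} \<subseteq> P"
    by auto
  then show False
    using F t P(2) ext_mono[of "{d \<in> E. d \<otimes> t \<in> E}" P T T] unfolding eflat_def by blast
qed

text \<open>The set below is the localization \<open>M\<^sub>P\<close>.\<close>

lemma localization_submodule:
  assumes F: "eflat E T" and P: "primeideal P (R\<lparr>carrier := E\<rparr>)" "\<one> \<notin> P \<cdot> T"
    and M: "M \<in> submodules R E"
  shows "{q \<in> carrier R. \<exists>s\<in>E - P. s \<otimes> q \<in> M} \<in> submodules R T" (is "?Q \<in> _")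
proof -
  note E = eflatD(1)[OF F] and T = eflatD(2,3)[OF F]
  have p: "P \<in> submodules R E" "P \<subseteq> E" "\<one> \<notin> P" "\<And>a b. a \<in> E \<Longrightarrow> b \<in> E \<Longrightarrow> a \<otimes> b \<in> P \<Longrightarrow> a \<in> P \<or> b \<in> P"
    using P(1) by (auto simp: primeideal_overring_iff[OF E])
  have prod: "s \<otimes> s' \<in> E - P" if "s \<in> E - P" "s' \<in> E - P" for s s'
    using that p(4) subringE(6)[OF E] by auto
  note cE = subsetD[OF subringE(1)[OF E]] and cT = subsetD[OF subringE(1)[OF T(1)]]
  note D = submodulesD[OF E M]
  show ?thesis
  proof (rule submodulesI[OF T(1)])
    show "?Q \<subseteq> carrier R" by auto
    show "\<zero> \<in> ?Q"
      using p(3) D(2) subringE(3)[OF E] by (auto intro!: bexI[of _ \<one>])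
    show "x \<oplus> y \<in> ?Q" if xy: "x \<in> ?Q" "y \<in> ?Q" for x y
    proof -
      obtain s s' where s: "s \<in> E - P" "s \<otimes> x \<in> M" "s' \<in> E - P" "s' \<otimes> y \<in> M"
        using xy by auto
      have "s' \<otimes> (s \<otimes> x) \<oplus> s \<otimes> (s' \<otimes> y) \<in> M"
        using s D by auto
      moreover have "s' \<otimes> (s \<otimes> x) \<oplus> s \<otimes> (s' \<otimes> y) = (s \<otimes> s') \<otimes> (x \<oplus> y)"
        using s xy cE by (simp add: r_distr m_ac)
      ultimately show ?thesis
        using prod s xy by auto
    qed
    show "t \<otimes> x \<in> ?Q" if tx: "t \<in> T" "x \<in> ?Q" for t x
    proof -
      obtain s s' where s: "s \<in> E - P" "s \<otimes> x \<in> M" "s' \<in> E - P" "s' \<otimes> t \<in> E"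
        using tx eflat_denominator[OF F P tx(1)] by auto
      have "(s' \<otimes> t) \<otimes> (s \<otimes> x) \<in> M"
        using s D by auto
      moreover have "(s' \<otimes> t) \<otimes> (s \<otimes> x) = (s \<otimes> s') \<otimes> (t \<otimes> x)"
        using s tx cE cT by (simp add: m_ac)
      ultimately show ?thesis
        using prod s tx cT by auto
    qed
  qed
qed

text \<open>The localization of \<open>M\<close> at \<open>P\<close> is a \<open>T\<close>-module
  containing \<open>M\<close>, hence \<open>M \<cdot> T\<close>. If it contained 1, some element of
  \<open>E\<close> outside \<open>P\<close> would lie in \<open>M\<close>.\<close>

lemma one_notin_ext_above_surviving_prime:
  assumes F: "eflat E T" and P: "primeideal P (R\<lparr>carrier := E\<rparr>)" "\<one> \<notin> P \<cdot> T"
    and M: "M \<in> submodules R E" "M \<inter> E \<subseteq> P"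
  shows "\<one> \<notin> M \<cdot> T"
proof
  assume one: "\<one> \<in> M \<cdot> T"
  let ?Q = "{q \<in> carrier R. \<exists>s\<in>E - P. s \<otimes> q \<in> M}"
  note E = eflatD(1)[OF F]
  have 1: "\<one> \<in> E - P"
    using P(1) subringE(3)[OF E] by (auto simp: primeideal_overring_iff[OF E])
  have "M \<subseteq> ?Q"
    using submodulesD(1)[OF E M(1)] 1 by (auto intro!: bexI[of _ \<one>])
  then have "\<one> \<in> ?Q"
    using ext_least[OF eflatD(2)[OF F] localization_submodule[OF F P M(1)]] one by blast
  then obtain s where s: "s \<in> E - P" "s \<otimes> \<one> \<in> M"
    by auto
  then have "s \<otimes> \<one> = s"
    using subringE(1)[OF E] by auto
  then show False
    using s M(2) by auto
qed

text \<open>The prime of \<open>T\<close> above \<open>P\<close> is the intersection of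
  \<open>T\<close> with the localization of \<open>P\<close>. Denominators outside \<open>P\<close>
  carry elements of \<open>T\<close> into \<open>E\<close>, where the primality of \<open>P\<close>
  applies.\<close>

lemma surviving_prime_contracted:
  assumes F: "eflat E T" and P: "primeideal P (R\<lparr>carrier := E\<rparr>)" "\<one> \<notin> P \<cdot> T"
  shows "P \<in> contracted_primes R E T"
proof -
  note E = eflatD(1)[OF F] and T = eflatD(2,3)[OF F]
  have p: "P \<in> submodules R E" "P \<subseteq> E" "\<one> \<notin> P" "\<And>a b. a \<in> E \<Longrightarrow> b \<in> E \<Longrightarrow> a \<otimes> b \<in> P \<Longrightarrow> a \<in> P \<or> b \<in> P"
    using P(1) by (auto simp: primeideal_overring_iff[OF E])
  note cE = subsetD[OF subringE(1)[OF E]] and cT = subsetD[OF subringE(1)[OF T(1)]]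
  note D = submodulesD[OF E p(1)]
  define Q where "Q = {q \<in> carrier R. \<exists>s\<in>E - P. s \<otimes> q \<in> P} \<inter> T"
  have "primeideal Q (R\<lparr>carrier := T\<rparr>)"
    unfolding primeideal_overring_iff[OF T(1)]
  proof (intro conjI ballI impI)
    show "Q \<in> submodules R T"
      unfolding Q_def
      by (intro submodules_Int localization_submodule[OF F P] p subring_self_submodule T)
    show "Q \<subseteq> T" by (auto simp: Q_def)
    show "\<one> \<notin> Q" by (auto simp: Q_def cE)
    fix a b assume ab: "a \<in> T" "b \<in> T" "a \<otimes> b \<in> Q"
    then obtain s where s: "s \<in> E - P" "s \<otimes> (a \<otimes> b) \<in> P"
      by (auto simp: Q_def)
    obtain u v where uv: "u \<in> E - P" "u \<otimes> a \<in> E" "v \<in> E - P" "v \<otimes> b \<in> E"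
      using eflat_denominator[OF F P] ab by meson
    have "(u \<otimes> v) \<otimes> (s \<otimes> (a \<otimes> b)) \<in> P"
      using D(4) uv s subringE(6)[OF E] by auto
    moreover have "(u \<otimes> v) \<otimes> (s \<otimes> (a \<otimes> b)) = s \<otimes> ((u \<otimes> a) \<otimes> (v \<otimes> b))"
      using ab uv s cE cT by (simp add: m_ac)
    ultimately have "u \<otimes> a \<in> P \<or> v \<otimes> b \<in> P"
      using p(4) s uv subringE(6)[OF E] by (metis DiffE)
    then show "a \<in> Q \<or> b \<in> Q"
      using uv ab cT by (auto simp: Q_def)
  qed
  moreover have "Q \<inter> E = P"
  proof
    show "Q \<inter> E \<subseteq> P"
      using p(4) by (auto simp: Q_def)
    show "P \<subseteq> Q \<inter> E"
      using p T(2) cE subringE(3)[OF E] by (auto simp: Q_def intro!: bexI[of _ \<one>])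
  qed
  ultimately show ?thesis
    by (auto simp: contracted_primes_def)
qed

section \<open>Composita of overrings\<close>

lemma subring_ext:
  assumes A: "subring A R" and B: "subring B R"
  shows "subring (A \<cdot> B) R" "A \<subseteq> A \<cdot> B" "B \<subseteq> A \<cdot> B"
proof -
  note cA = subsetD[OF subringE(1)[OF A]] and cB = subsetD[OF subringE(1)[OF B]]
  have comm: "A \<cdot> B = B \<cdot> A"
    using ext_comm A B subringE(1) by metis
  have sB: "A \<cdot> B \<in> submodules R B" and sA: "A \<cdot> B \<in> submodules R A"
    using ext_submodule[OF B subringE(1,4)[OF A]] ext_submodule[OF A subringE(1,4)[OF B]] comm by auto
  show AB: "A \<subseteq> A \<cdot> B" "B \<subseteq> A \<cdot> B"
    using ext_incl[OF B subringE(1)[OF A]] ext_incl[OF A subringE(1)[OF B]] comm by auto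
  note D = submodulesD[OF B sB]
  \<comment> \<open>By commutativity of the extension, \<open>A \<cdot> B\<close> is a module over
    both \<open>A\<close> and \<open>B\<close>, so multiplying by \<open>i\<close> in
    \<open>A\<close> and \<open>j\<close> in \<open>B\<close> stays inside it.\<close>
  have mult: "v \<otimes> u \<in> A \<cdot> B" if u: "u \<in> A \<cdot> B" and v: "v \<in> A \<cdot> B" for u v
    using v
  proof induct
    case (prod i j)
    have "i \<otimes> (j \<otimes> u) \<in> A \<cdot> B"
      using prod u D(4) submodulesD(4)[OF A sA] by blast
    then show ?case
      using prod cA cB u D(1) by (simp add: m_assoc subset_iff)
  next
    case (sum s t)
    then show ?case
      using u D(1,3) by (simp add: l_distr subset_iff)
  qed
  show "subring (A \<cdot> B) R"
    using mult D submodules_neg[OF B sB] AB subringE(3)[OF A] by (intro subringI) auto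
qed

lemma mult_inv_cancel:
  assumes "x \<in> carrier R" "x \<noteq> \<zero>" "y \<in> carrier R"
  shows "(x \<otimes> y) \<otimes> inv x = y" "x \<otimes> (y \<otimes> inv x) = y"
proof -
  note i = inv_nonzero[OF assms(1,2)]
  have "x \<otimes> (y \<otimes> inv x) = y \<otimes> (x \<otimes> inv x)"
    using assms i by (intro m_lcomm) auto
  then show "x \<otimes> (y \<otimes> inv x) = y"
    using assms i by simp
  then show "(x \<otimes> y) \<otimes> inv x = y"
    using assms i by (simp add: m_assoc)
qed

lemma unit_cancel:
  assumes "d \<in> carrier R" "x \<in> carrier R" "u \<in> carrier R" "\<one> = d \<otimes> u"
  shows "(d \<otimes> x) \<otimes> u = x"
proof -
  have "(d \<otimes> x) \<otimes> u = x \<otimes> (d \<otimes> u)"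
    using assms(1-3) by (simp add: m_ac)
  then show ?thesis
    using assms(2) by (simp flip: assms(4))
qed

lemma quotient_field_fraction:
  "quotient_field R E \<Longrightarrow> x \<in> carrier R \<Longrightarrow> \<exists>a\<in>E. \<exists>b\<in>E - {\<zero>}. x = a \<otimes> inv b"
  by (simp add: quotient_field_def)

text \<open>A nonzero \<open>b\<close> in \<open>E\<close> that is not invertible in
  \<open>A \<cdot> B\<close> lies in a prime of that ring. Its contraction to \<open>E\<close>
  passes through \<open>A\<close> as well as through \<open>B\<close>, so it is a nonzero prime in
  both contracted sets. Hence all denominators are invertible.\<close>

lemma independent_ext_carrier:
  assumes qf: "quotient_field R E" and A: "subring A R" "E \<subseteq> A" and B: "subring B R" "E \<subseteq> B"
    and ind: "contracted_primes R E A \<inter> contracted_primes R E B \<subseteq> {{\<zero>}}"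
  shows "A \<cdot> B = carrier R"
proof
  note AB = subring_ext[OF A(1) B(1)]
  show "A \<cdot> B \<subseteq> carrier R"
    using subringE(1)[OF AB(1)] .
  note cE = subset_trans[OF A(2) subringE(1)[OF A(1)]]
  have inv: "inv b \<in> A \<cdot> B" if b: "b \<in> E" "b \<noteq> \<zero>" for b
  proof (rule ccontr)
    assume nb: "inv b \<notin> A \<cdot> B"
    have bc: "b \<in> carrier R" using b cE by auto
    note i = inv_nonzero[OF bc b(2)]
    let ?C = "b <#\<^bsub>R\<^esub> (A \<cdot> B)"
    have bAB: "b \<in> A \<cdot> B" using b A AB by auto
    have C: "?C \<in> submodules R (A \<cdot> B)"
      by (intro submodules_scale subring_self_submodule AB bc)
    have "?C \<subseteq> A \<cdot> B"
      using bAB subringE(6)[OF AB(1)] by (auto simp: mem_scale)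
    moreover have "\<one> \<notin> ?C"
    proof
      assume "\<one> \<in> ?C"
      then obtain u where u: "u \<in> A \<cdot> B" "\<one> = b \<otimes> u"
        by (auto simp: mem_scale)
      then have "inv b = u"
        using subringE(1)[OF AB(1)] bc by (metis comm_inv_char subsetD)
      then show False using nb u by simp
    qed
    ultimately obtain Q where Q: "primeideal Q (R\<lparr>carrier := A \<cdot> B\<rparr>)" "?C \<subseteq> Q"
      using exists_prime_above[OF AB(1) C] by blast
    have "b \<otimes> \<one> \<in> ?C"
      using subringE(3)[OF AB(1)] by (auto simp: mem_scale)
    then have bQ: "b \<in> Q" using Q bc by auto
    have "Q \<inter> E = (Q \<inter> A) \<inter> E" "Q \<inter> E = (Q \<inter> B) \<inter> E"
      using A(2) B(2) by auto
    then have "Q \<inter> E \<in> contracted_primes R E A" "Q \<inter> E \<in> contracted_primes R E B"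
      using contracted_prime[OF A(1) AB(1,2) Q(1)] contracted_prime[OF B(1) AB(1,3) Q(1)]
      unfolding contracted_primes_def by blast+
    then have "Q \<inter> E = {\<zero>}" using ind by auto
    then show False using bQ b by auto
  qed
  show "carrier R \<subseteq> A \<cdot> B"
  proof
    fix x assume "x \<in> carrier R"
    then obtain a b where "a \<in> E" "b \<in> E - {\<zero>}" "x = a \<otimes> inv b"
      using quotient_field_fraction[OF qf] by meson
    then show "x \<in> A \<cdot> B"
      using inv[of b] A(2) AB subringE(6)[OF AB(1)] by auto
  qed
qed

section \<open>Clearing denominators\<close>

lemma quotient_fieldD:
  assumes "quotient_field R E"
  shows "subring E R" "\<And>x. x \<in> carrier R \<Longrightarrow> \<exists>d\<in>E - {\<zero>}. d \<otimes> x \<in> E"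
proof -
  show E: "subring E R"
    using assms by (auto simp: quotient_field_def subdomain_def subcring_def)
  show "\<exists>d\<in>E - {\<zero>}. d \<otimes> x \<in> E" if x: "x \<in> carrier R" for x
  proof -
    obtain a b where ab: "a \<in> E" "b \<in> E - {\<zero>}" "x = a \<otimes> inv b"
      using quotient_field_fraction[OF assms x] by meson
    then have "a \<in> carrier R" "b \<in> carrier R" using subringE(1)[OF E] by auto
    then have "b \<otimes> x = a"
      using ab inv_nonzero[of b] by (simp add: m_lcomm)
    then show ?thesis using ab by blast
  qed
qed

lemma common_denominator:
  assumes qf: "quotient_field R E" and "finite Y" "Y \<subseteq> carrier R"
  shows "\<exists>d\<in>E - {\<zero>}. \<forall>x\<in>Y. d \<otimes> x \<in> E"
  using assms(2,3)
proof induct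
  case empty
  show ?case
    using subringE(3)[OF quotient_fieldD(1)[OF qf]] by (auto intro!: bexI[of _ \<one>])
next
  case (insert x Y)
  note E = quotient_fieldD(1)[OF qf]
  note cE = subsetD[OF subringE(1)[OF E]]
  obtain d where d: "d \<in> E - {\<zero>}" "\<forall>y\<in>Y. d \<otimes> y \<in> E"
    using insert by auto
  obtain e where e: "e \<in> E - {\<zero>}" "e \<otimes> x \<in> E"
    using quotient_fieldD(2)[OF qf, of x] insert by blast
  have "d \<otimes> e \<in> E - {\<zero>}"
    using d e cE subringE(6)[OF E] integral[of d e] by blast
  moreover have "(d \<otimes> e) \<otimes> x = d \<otimes> (e \<otimes> x)" and "\<And>y. y \<in> Y \<Longrightarrow> (d \<otimes> e) \<otimes> y = e \<otimes> (d \<otimes> y)"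
    using d e cE insert by (auto simp: m_ac)
  ultimately show ?case
    using d e subringE(6)[OF E] by (intro bexI[of _ "d \<otimes> e"]) auto
qed

text \<open>Multiplying \<open>m\<close> by a denominator from \<open>D\<close> moves it into
  \<open>D\<close> and keeps it in \<open>M\<close>.\<close>

lemma nonzero_contraction:
  assumes qf: "quotient_field R D" and M: "M \<in> submodules R D" "m \<in> M" "m \<noteq> \<zero>"
  shows "\<exists>d\<in>M \<inter> D. d \<noteq> \<zero>"
proof -
  note D = quotient_fieldD(1)[OF qf]
  have m: "m \<in> carrier R" using submodulesD(1)[OF D M(1)] M by auto
  obtain d where d: "d \<in> D - {\<zero>}" "d \<otimes> m \<in> D"
    using quotient_fieldD(2)[OF qf m] by auto
  then have "d \<otimes> m \<in> M" "d \<otimes> m \<noteq> \<zero>"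
    using submodulesD(4)[OF D M(1)] M m integral[of d m] subringE(1)[OF D] by auto
  then show ?thesis using d by auto
qed


section \<open>Jaffard overrings\<close>

text \<open>\<open>S\<close> is the intersection of the other members of a Jaffard family containing
  \<open>T\<close>. Completeness puts \<open>S\<close> inside every flat overring independent of
  \<open>T\<close>, which need not belong to the family. Local finiteness turns divisibility by
  \<open>d\<close> in \<open>S\<close> into finitely many conditions, each of which becomes vacuous
  over \<open>T\<close> by independence.\<close>

lemma jaffard_complement:
  assumes qf: "quotient_field R E" and J: "jaffard_overring R E T"
  obtains S where "S \<subseteq> carrier R"
    "\<And>T'. eflat E T' \<Longrightarrow> contracted_primes R E T \<inter> contracted_primes R E T' \<subseteq> {{\<zero>}} \<Longrightarrow> S \<subseteq> T'"
    "\<And>d. d \<in> E \<Longrightarrow> d \<noteq> \<zero> \<Longrightarrow> \<one> \<in> ((d <#\<^bsub>R\<^esub> S) \<inter> E) \<cdot> T"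
proof -
  obtain \<Psi> where \<Psi>: "jaffard_family R E \<Psi>" "T \<in> \<Psi>"
    using J by (auto simp: jaffard_overring_def)
  have flat: "eflat E A" if "A \<in> \<Psi>" for A
    using \<Psi> that flat_overring_imp_eflat[OF qf] by (auto simp: jaffard_family_def)
  have complete: "complete_family R E \<Psi>" and ind: "independent_family R E \<Psi>"
    and lf: "locally_finite_family R \<Psi>"
    using \<Psi> by (auto simp: jaffard_family_def)
  note E = quotient_fieldD(1)[OF qf]
  note cE = subsetD[OF subringE(1)[OF E]]
  \<comment> \<open>The factor \<open>carrier R\<close> gives the value K when \<open>T\<close> is
    the only member.\<close>
  define S where "S = carrier R \<inter> \<Inter>(\<Psi> - {T})"
  have "S \<subseteq> T'" if T': "eflat E T'" "contracted_primes R E T \<inter> contracted_primes R E T' \<subseteq> {{\<zero>}}" for T'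
  proof
    fix x assume x: "x \<in> S"
    then have xc: "x \<in> carrier R" by (auto simp: S_def)
    note T'r = eflatD(2,3)[OF T'(1)]
    let ?C = "{d \<in> E. d \<otimes> x \<in> E}"
    have Cs: "?C \<in> submodules R E"
      by (rule colon_submodule[OF E E order_refl subring_self_submodule[OF E] xc])
    have CT: "?C \<cdot> T' \<in> submodules R T'" "?C \<cdot> T' \<subseteq> T'"
    proof -
      show "?C \<cdot> T' \<in> submodules R T'"
        using submodulesD(1,2)[OF E Cs] by (intro ext_submodule T'r) blast+
      show "?C \<cdot> T' \<subseteq> T'"
        using T'r(2) by (intro ext_least subring_self_submodule T'r) blast
    qed
    \<comment> \<open>Otherwise the denominators of \<open>x\<close> lie in a nonzero prime
      contracted from \<open>T'\<close>. By completeness it survives in some \<open>A\<close> of the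
      family, and by independence \<open>A\<close> is not \<open>T\<close>. So \<open>x\<close> lies
      in \<open>A\<close>, and flatness makes its denominators generate the unit ideal of
      \<open>A\<close>, a contradiction.\<close>
    have "\<one> \<in> ?C \<cdot> T'"
    proof (rule ccontr)
      assume "\<one> \<notin> ?C \<cdot> T'"
      then obtain Q where Q: "primeideal Q (R\<lparr>carrier := T'\<rparr>)" "?C \<cdot> T' \<subseteq> Q"
        using exists_prime_above[OF T'r(1) CT] by auto
      have P: "primeideal (Q \<inter> E) (R\<lparr>carrier := E\<rparr>)" "Q \<inter> E \<in> contracted_primes R E T'"
        using contracted_prime[OF E T'r Q(1)] Q(1) by (auto simp: contracted_primes_def)
      have CP: "?C \<subseteq> Q \<inter> E"
        using ext_incl[OF T'r(1) submodulesD(1)[OF E Cs]] Q(2) by auto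
      have "Q \<inter> E \<noteq> {\<zero>}"
        using CP quotient_fieldD(2)[OF qf xc] by auto
      then have PT: "Q \<inter> E \<notin> contracted_primes R E T"
        using P(2) T'(2) by auto
      have Pi: "ideal (Q \<inter> E) (R\<lparr>carrier := E\<rparr>)" "\<one> \<notin> Q \<inter> E"
        using P(1) by (auto simp: primeideal_overring_iff[OF E] ideal_overring_iff[OF E])
      then have "Q \<inter> E = carrier R \<inter> (\<Inter>A\<in>\<Psi>. (Q \<inter> E) \<cdot> A)"
        using complete unfolding complete_family_def by blast
      then obtain A where A: "A \<in> \<Psi>" "\<one> \<notin> (Q \<inter> E) \<cdot> A"
        using Pi(2) one_closed by blast
      then have "Q \<inter> E \<in> contracted_primes R E A"
        using surviving_prime_contracted[OF flat P(1)] by blast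
      then have "A \<noteq> T" using PT by auto
      then have "x \<in> A" using x A by (auto simp: S_def)
      then have "\<one> \<in> ?C \<cdot> A" using flat[OF A(1)] by (auto simp: eflat_def)
      then show False using ext_mono[OF CP order_refl] A(2) by blast
    qed
    then show "x \<in> T'"
      by (rule ext_colon_imp_mem[OF E T'r subring_self_submodule[OF T'r(1)] xc])
        (use T'r in auto)
  qed
  moreover have "\<one> \<in> ((d <#\<^bsub>R\<^esub> S) \<inter> E) \<cdot> T" if d: "d \<in> E" "d \<noteq> \<zero>" for d
  proof -
    note Tr = eflatD(2,3)[OF flat[OF \<Psi>(2)]]
    have dc: "d \<in> carrier R" using d cE by auto
    \<comment> \<open>Where \<open>d\<close> is a unit, divisibility by \<open>d\<close> is
      automatic; only the finitely many members in \<open>G\<close> impose a condition.\<close>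
    define G where "G = {A \<in> \<Psi>. d \<notin> Units (R\<lparr>carrier := A\<rparr>)} - {T}"
    have fin: "finite G" and sub: "G \<subseteq> \<Psi> - {T}"
      using lf d dc by (auto simp: G_def locally_finite_family_def)
    define I where "I H = {z \<in> E. \<forall>A\<in>H. z \<in> d <#\<^bsub>R\<^esub> A}" for H
    have scale: "d <#\<^bsub>R\<^esub> A \<in> submodules R E" if "A \<in> \<Psi>" for A
      using flat[OF that] by (intro submodules_scale E overring_submodule dc) (auto dest: eflatD)
    \<comment> \<open>Each further \<open>A\<close> intersects with dA. Since (dA)T = d(AT) = K
      contains 1, and extension to the flat \<open>T\<close> commutes with intersections, 1 is never
      lost.\<close>
    have "I G \<in> submodules R E \<and> \<one> \<in> I G \<cdot> T"
      using fin sub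
    proof induct
      case empty
      have "I {} = E" by (auto simp: I_def)
      then show ?case
        using subring_self_submodule[OF E] ext_incl[OF Tr(1) subringE(1)[OF E]] subringE(3)[OF E] by auto
    next
      case (insert A H)
      then have A: "A \<in> \<Psi>" "A \<noteq> T" and H: "I H \<in> submodules R E" "\<one> \<in> I H \<cdot> T" by auto
      have IH: "I (insert A H) = I H \<inter> (d <#\<^bsub>R\<^esub> A)" by (auto simp: I_def)
      note Ar = eflatD(2,3)[OF flat[OF A(1)]]
      have "contracted_primes R E A \<inter> contracted_primes R E T \<subseteq> {{\<zero>}}"
        using ind A \<Psi>(2) unfolding independent_family_def by blast
      then have "A \<cdot> T = carrier R"
        by (rule independent_ext_carrier[OF qf Ar Tr])
      then have "(d <#\<^bsub>R\<^esub> A) \<cdot> T = d <#\<^bsub>R\<^esub> carrier R"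
        using ext_scale[OF Tr(1) subringE(1,4)[OF Ar(1)] dc] by simp
      then have "\<one> \<in> (d <#\<^bsub>R\<^esub> A) \<cdot> T"
        using inv_nonzero[OF dc d(2)] by (auto simp: mem_scale intro!: bexI[of _ "inv d"])
      then show ?case
        using eflat_ext_Int[OF flat[OF \<Psi>(2)] H(1) scale[OF A(1)]] H scale[OF A(1)] submodules_Int[OF E]
          IH by auto
    qed
    moreover have "I G \<subseteq> (d <#\<^bsub>R\<^esub> S) \<inter> E"
    proof
      fix z assume z: "z \<in> I G"
      then have zE: "z \<in> E" "z \<in> carrier R" using cE by (auto simp: I_def)
      note i = inv_nonzero[OF dc d(2)]
      have "z \<otimes> inv d \<in> A" if A: "A \<in> \<Psi> - {T}" for A
      proof (cases "A \<in> G")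
        case True
        then obtain a where "a \<in> A" "z = d \<otimes> a" using z by (auto simp: I_def mem_scale)
        moreover have "a \<in> carrier R"
          using \<open>a \<in> A\<close> A flat eflatD(2) subringE(1) by blast
        moreover have "z \<otimes> inv d = a"
          using calculation mult_inv_cancel[OF dc d(2)] by simp
        ultimately show ?thesis by simp
      next
        case False
        then obtain u where u: "u \<in> A" "d \<otimes> u = \<one>"
          using A by (auto simp: G_def Units_def)
        have Ar: "subring A R" "E \<subseteq> A"
          using A flat eflatD(2,3) by blast+
        then have "inv d = u"
          using u dc subsetD[OF subringE(1)[OF Ar(1)]] by (intro comm_inv_char) auto
        then show ?thesis
          using subringE(6)[OF Ar(1), of z u] u zE Ar by auto
      qed
      then have "z \<otimes> inv d \<in> S" using zE i by (auto simp: S_def)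
      moreover have "z = d \<otimes> (z \<otimes> inv d)" using zE mult_inv_cancel[OF dc d(2)] by simp
      ultimately show "z \<in> (d <#\<^bsub>R\<^esub> S) \<inter> E" using zE by (auto simp: mem_scale)
    qed
    ultimately show ?thesis using ext_mono by blast
  qed
  ultimately show ?thesis
    using that[of S] by (auto simp: S_def)
qed

end


section \<open>The derived sequence\<close>

lemma first_exists: "\<exists>\<beta>\<le>\<alpha>. is_first (\<beta> :: 'i::wellorder)"
  by (rule exI[of _ "LEAST \<beta>. \<beta> = \<beta>"]) (auto simp: is_first_def intro: Least_le)

locale pre_jaffard = field +
  fixes D :: "'a set" and \<Theta> :: "'a set set"
  assumes quotient_field: "quotient_field R D" and family: "pre_jaffard_family R D \<Theta>"
begin

abbreviation fam :: "'i::wellorder \<Rightarrow> 'a set set" where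
  "fam \<alpha> \<equiv> derived_family R D \<Theta> \<alpha>"

abbreviation stage :: "'i::wellorder \<Rightarrow> 'a set" where
  "stage \<alpha> \<equiv> derived_ring R D \<Theta> \<alpha>"

lemma D: "subring D R"
  using quotient_fieldD(1)[OF quotient_field] .

lemma family_flat: "T \<in> \<Theta> \<Longrightarrow> eflat D T"
  using family flat_overring_imp_eflat[OF quotient_field] by (auto simp: pre_jaffard_family_def)

lemmas family_subring = eflatD(2)[OF family_flat] and family_overring = eflatD(3)[OF family_flat]

lemma family_independent:
  "A \<in> \<Theta> \<Longrightarrow> B \<in> \<Theta> \<Longrightarrow> A \<noteq> B \<Longrightarrow> contracted_primes R D A \<inter> contracted_primes R D B \<subseteq> {{\<zero>}}"
  using family by (auto simp: pre_jaffard_family_def independent_family_def)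

text \<open>Otherwise 1 would lie in all extensions of \<open>P\<close>, whose intersection is
  \<open>P\<close> by completeness.\<close>

lemma family_survive:
  assumes "primeideal P (R\<lparr>carrier := D\<rparr>)"
  shows "\<exists>T\<in>\<Theta>. \<one> \<notin> P \<cdot> T"
proof -
  have "ideal P (R\<lparr>carrier := D\<rparr>)" "\<one> \<notin> P"
    using assms by (auto simp: primeideal_overring_iff[OF D] ideal_overring_iff[OF D])
  then show ?thesis
    using family one_closed unfolding pre_jaffard_family_def complete_family_def by blast
qed

lemma fam_antimono: "\<beta> \<le> \<alpha> \<Longrightarrow> fam \<alpha> \<subseteq> fam \<beta>"
proof (induction \<alpha> arbitrary: \<beta> rule: less_induct)
  case (less \<alpha>)
  consider "is_first \<alpha>" | \<gamma> where "is_succ_of \<alpha> \<gamma>" | "is_limit \<alpha>"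
    by (auto simp: is_limit_def)
  then show ?case
  proof cases
    case 1
    then have "\<beta> = \<alpha>" using less.prems by (auto simp: is_first_def intro: antisym)
    then show ?thesis by simp
  next
    case 2
    then have "\<gamma> < \<alpha>" "\<beta> = \<alpha> \<or> \<beta> \<le> \<gamma>"
      using less.prems by (auto simp: is_succ_of_def le_less)
    then show ?thesis
      using less.IH[of \<gamma> \<beta>] derived_family_succ[OF 2, of R D \<Theta>] by blast
  next
    case 3
    show ?thesis
      using less.prems derived_family_limit[OF 3, of R D \<Theta>] by (cases "\<beta> = \<alpha>") auto
  qed
qed

lemma fam_subset: "fam \<alpha> \<subseteq> \<Theta>"
  using first_exists[of \<alpha>] fam_antimono derived_family_first by metis

text \<open>Members leave the chain only at successor steps, and there only as Jaffard overrings; a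
  member missing at a limit is missing earlier.\<close>

lemma removed_at_stage:
  assumes "T \<in> \<Theta>" "T \<notin> fam \<alpha>"
  shows "\<exists>\<rho><\<alpha>. T \<in> fam \<rho> \<and> jaffard_overring R (stage \<rho>) T"
  using assms(2)
proof (induction \<alpha> rule: less_induct)
  case (less \<alpha>)
  consider "is_first \<alpha>" | \<gamma> where "is_succ_of \<alpha> \<gamma>" | "is_limit \<alpha>"
    by (auto simp: is_limit_def)
  then show ?case
  proof cases
    case 1
    then show ?thesis using less.prems assms by (simp add: derived_family_first)
  next
    case 2
    note g = is_succ_of_less[OF 2]
    show ?thesis
    proof (cases "T \<in> fam \<gamma>")
      case True
      then show ?thesis
        using less.prems g derived_family_succ[OF 2, of R D \<Theta>] by blast
    next
      case False
      then show ?thesis using less.IH[OF g] g by (meson less_trans)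
    qed
  next
    case 3
    then obtain \<beta> where "\<beta> < \<alpha>" "T \<notin> fam \<beta>"
      using less.prems derived_family_limit[OF 3, of R D \<Theta>] by auto
    then show ?thesis using less.IH by (meson less_trans)
  qed
qed

text \<open>For the first ordinal this is completeness applied to the ideal \<open>D\<close> itself,
  which makes \<open>D\<close> the intersection of \<Theta>. Elsewhere the factor
  \<open>carrier R\<close> absorbs the default value K for an empty family.\<close>

lemma stage_eq: "stage \<alpha> = carrier R \<inter> \<Inter>(fam \<alpha>)"
proof (cases "is_first \<alpha>")
  case True
  have "ideal D (R\<lparr>carrier := D\<rparr>)"
    using subring_self_submodule[OF D] by (simp add: ideal_overring_iff[OF D])
  then have "D = carrier R \<inter> (\<Inter>T\<in>\<Theta>. D \<cdot> T)"
    using family unfolding pre_jaffard_family_def complete_family_def by blast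
  moreover have "D \<cdot> T = T" if "T \<in> \<Theta>" for T
    using that family_subring family_overring subringE(3)[OF D] by (intro ext_unital) auto
  ultimately show ?thesis
    using True by (simp add: derived_ring_first derived_family_first)
next
  case False
  have "T \<subseteq> carrier R" if "T \<in> fam \<alpha>" for T
    using that fam_subset family_subring subringE(1) by blast
  then show ?thesis
    unfolding derived_ring_not_first[OF False] by auto
qed

section \<open>The rings of the derived sequence\<close>

lemma stage_subset: "T \<in> fam \<alpha> \<Longrightarrow> stage \<alpha> \<subseteq> T"
  by (auto simp: stage_eq)

lemma stage_mono: "\<beta> \<le> \<alpha> \<Longrightarrow> stage \<beta> \<subseteq> stage \<alpha>"
  using fam_antimono[of \<beta> \<alpha>] by (auto simp: stage_eq)

lemma stage_subring: "subring (stage \<alpha>) R"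
proof -
  have "subring (\<Inter>(insert (carrier R) (fam \<alpha>))) R"
    using fam_subset[of \<alpha>] family_subring carrier_is_subring by (intro subring_Inter) auto
  then show ?thesis by (simp add: stage_eq)
qed

lemma stage_overring: "D \<subseteq> stage \<alpha>"
  using fam_subset[of \<alpha>] family_overring subringE(1)[OF D] by (auto simp: stage_eq)

lemma stage_quotient_field: "quotient_field R (stage \<alpha>)"
  using quotient_field_overring[OF quotient_field] stage_subring stage_overring
  by (auto simp: overrings_def)

lemma fam_flat: "T \<in> fam \<alpha> \<Longrightarrow> eflat (stage \<alpha>) T"
  using eflat_mono[OF family_flat stage_subring stage_overring stage_subset] fam_subset by blast

text \<open>A common prime over \<open>stage \<alpha>\<close> contracts to a common prime over
  \<open>D\<close>, which is zero. A nonzero \<open>D\<close>-submodule of K meets \<open>D\<close>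
  in a nonzero element, so the prime itself is zero.\<close>

lemma fam_independent:
  assumes "A \<in> fam \<alpha>" "B \<in> fam \<alpha>" "A \<noteq> B"
  shows "contracted_primes R (stage \<alpha>) A \<inter> contracted_primes R (stage \<alpha>) B \<subseteq> {{\<zero>}}"
proof
  let ?E = "stage \<alpha>"
  fix P assume P: "P \<in> contracted_primes R ?E A \<inter> contracted_primes R ?E B"
  have contr: "P \<inter> D \<in> contracted_primes R D C" if "P \<in> contracted_primes R ?E C" for C
    using that stage_overring[of \<alpha>] unfolding contracted_primes_def by (auto simp: Int_assoc Int_absorb1)
  have PD: "P \<inter> D = {\<zero>}"
    using P contr family_independent[of A B] assms fam_subset[of \<alpha>] by blast
  obtain Q where Q: "primeideal Q (R\<lparr>carrier := A\<rparr>)" "P = Q \<inter> ?E"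
    using P by (auto simp: contracted_primes_def)
  have A: "subring A R"
    using assms(1) fam_subset family_subring by blast
  have "primeideal P (R\<lparr>carrier := ?E\<rparr>)"
    using contracted_prime[OF stage_subring A stage_subset[OF assms(1)] Q(1)] Q(2) by simp
  then have P': "P \<in> submodules R D"
    using submodules_antimono[OF D stage_subring stage_overring]
    by (auto simp: primeideal_overring_iff[OF stage_subring])
  then have "P = {\<zero>}"
    using nonzero_contraction[OF quotient_field P'] PD submodulesD(2)[OF D P'] by blast
  then show "P \<in> {{\<zero>}}" by simp
qed

text \<open>The ring \<open>S\<close> is the intersection of the members other than \<open>T\<close> of a Jaffard family containing \<open>T\<close>.\<close>

lemma removed_complement:
  assumes "T \<in> \<Theta>" "T \<notin> fam \<alpha>"
  obtains \<rho> S where "\<rho> < \<alpha>" "T \<in> fam \<rho>" "S \<subseteq> carrier R" "\<And>T'. T' \<in> fam \<rho> \<Longrightarrow> T' \<noteq> T \<Longrightarrow> S \<subseteq> T'"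
    "\<And>d. d \<in> D \<Longrightarrow> d \<noteq> \<zero> \<Longrightarrow> \<one> \<in> ((d <#\<^bsub>R\<^esub> S) \<inter> stage \<rho>) \<cdot> T"
proof -
  obtain \<rho> where \<rho>: "\<rho> < \<alpha>" "T \<in> fam \<rho>" "jaffard_overring R (stage \<rho>) T"
    using removed_at_stage[OF assms] by blast
  obtain S where S: "S \<subseteq> carrier R"
    "\<And>T'. eflat (stage \<rho>) T' \<Longrightarrow> contracted_primes R (stage \<rho>) T \<inter> contracted_primes R (stage \<rho>) T' \<subseteq> {{\<zero>}} \<Longrightarrow> S \<subseteq> T'"
    "\<And>d. d \<in> stage \<rho> \<Longrightarrow> d \<noteq> \<zero> \<Longrightarrow> \<one> \<in> ((d <#\<^bsub>R\<^esub> S) \<inter> stage \<rho>) \<cdot> T"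
    using jaffard_complement[OF stage_quotient_field \<rho>(3)] by blast
  show ?thesis
  proof (rule that[OF \<rho>(1,2) S(1)])
    show "S \<subseteq> T'" if "T' \<in> fam \<rho>" "T' \<noteq> T" for T'
      using S(2) fam_flat fam_independent that \<rho>(2) by metis
    show "\<one> \<in> ((d <#\<^bsub>R\<^esub> S) \<inter> stage \<rho>) \<cdot> T" if "d \<in> D" "d \<noteq> \<zero>" for d
      using S(3) that stage_overring by blast
  qed
qed

text \<open>The members left in \<open>fam \<alpha>\<close> belong to \<open>fam \<rho>\<close> and
  differ from \<open>T\<close>, so they contain \<open>S\<close>. Thus \<open>stage \<alpha>\<close>
  contains both \<open>S\<close> and \<open>stage \<rho>\<close>.\<close>

lemma removed_complement_stage:
  assumes "T \<in> \<Theta>" "T \<notin> fam \<alpha>" "d \<in> D" "d \<noteq> \<zero>"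
  shows "\<one> \<in> (d <#\<^bsub>R\<^esub> stage \<alpha>) \<cdot> T \<and> \<one> \<in> ((d <#\<^bsub>R\<^esub> stage \<alpha>) \<inter> stage \<alpha>) \<cdot> T"
proof -
  obtain \<rho> S where \<rho>: "\<rho> < \<alpha>" "T \<in> fam \<rho>" "S \<subseteq> carrier R" "\<And>T'. T' \<in> fam \<rho> \<Longrightarrow> T' \<noteq> T \<Longrightarrow> S \<subseteq> T'"
    "\<one> \<in> ((d <#\<^bsub>R\<^esub> S) \<inter> stage \<rho>) \<cdot> T"
    using removed_complement[OF assms(1,2)] assms(3,4) by metis
  have "fam \<alpha> \<subseteq> fam \<rho> - {T}"
    using fam_antimono[OF less_imp_le[OF \<rho>(1)]] assms(2) by auto
  then have "S \<subseteq> stage \<alpha>"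
    using \<rho>(3,4) by (fastforce simp: stage_eq)
  then have "(d <#\<^bsub>R\<^esub> S) \<inter> stage \<rho> \<subseteq> (d <#\<^bsub>R\<^esub> stage \<alpha>) \<inter> stage \<alpha>"
    using stage_mono[OF less_imp_le[OF \<rho>(1)]] by (auto simp: l_coset_def)
  then show ?thesis
    using \<rho>(5) ext_mono[of _ "(d <#\<^bsub>R\<^esub> stage \<alpha>) \<inter> stage \<alpha>" T T] ext_mono[of "(d <#\<^bsub>R\<^esub> stage \<alpha>) \<inter> stage \<alpha>" "d <#\<^bsub>R\<^esub> stage \<alpha>" T T]
    by blast
qed

text \<open>If the colon ideal of \<open>x\<close> into \<open>N\<close> were proper, it would lie
  in a prime \<open>M\<close>. The contraction of \<open>M\<close> to \<open>D\<close> survives in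
  some \<open>T\<close> of \<Theta>, so \<open>M \<cdot> T\<close> omits 1. But it contains 1: for
  remaining \<open>T\<close> because the colon ideal generates the unit ideal there, for removed
  \<open>T\<close> because \<open>M\<close> contains all multiples in \<open>stage \<alpha>\<close>
  of some nonzero \<open>d\<close> in \<open>D\<close>.\<close>

lemma stage_complete:
  assumes ne: "fam \<alpha> \<noteq> {}" and N: "N \<in> submodules R (stage \<alpha>)" and x: "\<And>T. T \<in> fam \<alpha> \<Longrightarrow> x \<in> N \<cdot> T"
  shows "x \<in> N"
proof -
  let ?E = "stage \<alpha>"
  note E = stage_subring[of \<alpha>]
  have xc: "x \<in> carrier R"
  proof -
    obtain T where T: "T \<in> fam \<alpha>" using ne by blast
    have "subring T R" using T fam_subset family_subring by blast
    then show ?thesis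
      using x[OF T] submodulesD(1)[OF _ ext_submodule] submodulesD(1,2)[OF E N] by blast
  qed
  let ?B = "{e \<in> ?E. e \<otimes> x \<in> N}"
  have B: "?B \<in> submodules R ?E"
    by (rule colon_submodule[OF E E order_refl N xc])
  have B1: "\<one> \<in> ?B \<cdot> T" if T: "T \<in> fam \<alpha>" for T
    using eflat_colon[OF fam_flat[OF T] N x[OF T]] .
  have "\<one> \<in> ?B"
  proof (rule ccontr)
    assume "\<one> \<notin> ?B"
    then obtain M where M: "primeideal M (R\<lparr>carrier := ?E\<rparr>)" "?B \<subseteq> M"
      using exists_prime_above[OF E B] by auto
    have M': "M \<in> submodules R ?E" "M \<in> submodules R D" "\<one> \<notin> M"
      using M(1) submodules_antimono[OF D E stage_overring] by (auto simp: primeideal_overring_iff[OF E])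
    have P: "primeideal (M \<inter> D) (R\<lparr>carrier := D\<rparr>)"
      by (rule contracted_prime[OF D E stage_overring M(1)])
    obtain T where T: "T \<in> \<Theta>" "\<one> \<notin> (M \<inter> D) \<cdot> T"
      using family_survive[OF P] by blast
    have "\<one> \<notin> M \<cdot> T"
      by (rule one_notin_ext_above_surviving_prime[OF family_flat[OF T(1)] P T(2) M'(2) order_refl])
    moreover have "\<one> \<in> M \<cdot> T"
    proof (cases "T \<in> fam \<alpha>")
      case True
      then show ?thesis using B1[OF True] ext_mono[OF M(2) order_refl] by blast
    next
      case False
      obtain T1 where T1: "T1 \<in> fam \<alpha>" using ne by blast
      have sT1: "subring T1 R" using T1 fam_subset family_subring by blast
      \<comment> \<open>The colon ideal, contained in \<open>M\<close>, generates the unit ideal of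
        the remaining member \<open>T1\<close>.\<close>
      have "\<exists>m\<in>M. m \<noteq> \<zero>"
      proof (rule ccontr)
        assume "\<not> ?thesis"
        then have "?B \<subseteq> {\<zero>}" using M(2) by auto
        then have "?B \<cdot> T1 \<subseteq> {\<zero>}"
          by (intro ext_least sT1 zero_submodule)
        then show False using B1[OF T1] by auto
      qed
      then obtain d where d: "d \<in> M" "d \<in> D" "d \<noteq> \<zero>"
        using nonzero_contraction[OF quotient_field M'(2)] by blast
      have "d <#\<^bsub>R\<^esub> ?E \<subseteq> M"
      proof
        fix z assume "z \<in> d <#\<^bsub>R\<^esub> ?E"
        then obtain e where "e \<in> ?E" "z = d \<otimes> e" by (auto simp: mem_scale)
        moreover from this have "z = e \<otimes> d"
          using d subringE(1)[OF E] subringE(1)[OF D] by (simp add: m_comm subset_iff)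
        ultimately show "z \<in> M" using submodulesD(4)[OF E M'(1), of e d] d by simp
      qed
      then show ?thesis
        using removed_complement_stage[OF T(1) False d(2,3)] ext_mono[OF _ order_refl] by blast
    qed
    ultimately show False by simp
  qed
  then show ?thesis using xc by simp
qed

text \<open>Since 1 is divisible in \<open>stage \<alpha> \<cdot> T\<close> by every nonzero element
  of \<open>D\<close>, in particular by a denominator of \<open>x\<close>, every \<open>x\<close> of
  K lies there.\<close>

lemma removed_ext_stage:
  assumes "T \<in> \<Theta>" "T \<notin> fam \<alpha>"
  shows "stage \<alpha> \<cdot> T = carrier R"
proof
  have T: "subring T R" "D \<subseteq> T" using assms family_subring family_overring by auto
  note E = stage_subring[of \<alpha>]
  have sub: "stage \<alpha> \<cdot> T \<in> submodules R T"
    using ext_submodule[OF T(1) subringE(1,4)[OF E]] .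
  show "stage \<alpha> \<cdot> T \<subseteq> carrier R"
    using submodulesD(1)[OF T(1) sub] .
  show "carrier R \<subseteq> stage \<alpha> \<cdot> T"
  proof
    fix x assume x: "x \<in> carrier R"
    then obtain d where d: "d \<in> D - {\<zero>}" "d \<otimes> x \<in> D"
      using quotient_fieldD(2)[OF quotient_field] by blast
    have dc: "d \<in> carrier R" using d subringE(1)[OF D] by auto
    have "\<one> \<in> d <#\<^bsub>R\<^esub> (stage \<alpha> \<cdot> T)"
      using removed_complement_stage[OF assms, of d] d ext_scale[OF T(1) subringE(1,4)[OF E] dc] by auto
    then obtain u where u: "u \<in> stage \<alpha> \<cdot> T" "\<one> = d \<otimes> u" by (auto simp: mem_scale)
    have "(d \<otimes> x) \<otimes> u \<in> stage \<alpha> \<cdot> T"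
      using u d T by (intro submodulesD(4)[OF T(1) sub]) auto
    moreover have "(d \<otimes> x) \<otimes> u = x"
      using u x dc submodulesD(1)[OF T(1) sub] by (intro unit_cancel) auto
    ultimately show "x \<in> stage \<alpha> \<cdot> T" by simp
  qed
qed

text \<open>Completeness over \<open>stage \<alpha>\<close> allows the condition to be tested in
  each remaining \<open>T\<close>, where it follows from flatness of \<open>T\<close> over
  \<open>D\<close>. If nothing remains, the ring is K and a denominator is simply inverted.\<close>

lemma stage_flat: "eflat D (stage \<alpha>)"
  unfolding eflat_def
proof (intro conjI ballI)
  note E = stage_subring[of \<alpha>]
  show "subring D R" "subring (stage \<alpha>) R" "D \<subseteq> stage \<alpha>"
    using D E stage_overring by auto
  fix t assume t: "t \<in> stage \<alpha>"
  then have tc: "t \<in> carrier R" using subringE(1)[OF E] by auto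
  let ?C = "{d \<in> D. d \<otimes> t \<in> D}"
  have C: "?C \<in> submodules R D"
    by (rule colon_submodule[OF D D order_refl subring_self_submodule[OF D] tc])
  note CD = submodulesD[OF D C]
  have CE: "?C \<cdot> stage \<alpha> \<in> submodules R (stage \<alpha>)"
    using CD by (intro ext_submodule E) auto
  show "\<one> \<in> ?C \<cdot> stage \<alpha>"
  proof (cases "fam \<alpha> = {}")
    case True
    then have K: "stage \<alpha> = carrier R" by (simp add: stage_eq)
    obtain d where d: "d \<in> D - {\<zero>}" "d \<otimes> t \<in> D"
      using quotient_fieldD(2)[OF quotient_field tc] by blast
    then have "d \<in> carrier R" "d \<noteq> \<zero>" using subringE(1)[OF D] by auto
    note i = inv_nonzero[OF this]
    have "d \<otimes> inv d \<in> ?C \<cdot> stage \<alpha>"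
      using d i K by (intro ideal_prod.prod) auto
    then show ?thesis using i by simp
  next
    case False
    show ?thesis
    proof (rule stage_complete[OF False CE])
      fix T assume T: "T \<in> fam \<alpha>"
      then have T': "T \<in> \<Theta>" using fam_subset by blast
      have "\<one> \<in> ?C \<cdot> T"
        using family_flat[OF T'] stage_subset[OF T] t by (auto simp: eflat_def)
      then show "\<one> \<in> (?C \<cdot> stage \<alpha>) \<cdot> T"
        using ext_mono[OF ext_incl[OF E CD(1)] order_refl] by blast
    qed
  qed
qed

text \<open>Every removed \<open>T\<close> has a Zariski neighbourhood whose members other than \<open>T\<close> at the stage where \<open>T\<close>
  is removed contain \<open>Y\<close>. These neighbourhoods and \<open>{T. Y \<subseteq> T}\<close> cover \<open>\<Theta>\<close>.\<close>

lemma stage_cofinite: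
  assumes nf: "\<not> is_first \<alpha>" and Y: "finite Y" "Y \<subseteq> stage \<alpha>"
  obtains \<beta> F where "\<beta> < \<alpha>" "finite F" "F \<subseteq> \<Theta>" "F \<inter> fam \<alpha> = {}" "\<And>T. T \<in> fam \<beta> \<Longrightarrow> T \<notin> F \<Longrightarrow> Y \<subseteq> T"
proof -
  have Yc: "Y \<subseteq> carrier R" using Y subringE(1)[OF stage_subring] by blast
  obtain d where d: "d \<in> D - {\<zero>}" "\<forall>x\<in>Y. d \<otimes> x \<in> D"
    using common_denominator[OF quotient_field Y(1) Yc] by blast
  have dc: "d \<in> carrier R" "d \<noteq> \<zero>" using d subringE(1)[OF D] by auto
  have ex: "\<exists>Z \<rho>. finite Z \<and> Z \<subseteq> T \<and> \<rho> < \<alpha> \<and> (\<forall>T'\<in>fam \<rho>. T' \<noteq> T \<longrightarrow> Z \<subseteq> T' \<longrightarrow> Y \<subseteq> T')"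
    if T: "T \<in> \<Theta>" "T \<notin> fam \<alpha>" for T
  proof -
    obtain \<rho> S where \<rho>: "\<rho> < \<alpha>" "T \<in> fam \<rho>" "\<And>T'. T' \<in> fam \<rho> \<Longrightarrow> T' \<noteq> T \<Longrightarrow> S \<subseteq> T'"
      "\<one> \<in> ((d <#\<^bsub>R\<^esub> S) \<inter> stage \<rho>) \<cdot> T"
      using removed_complement[OF T] d by (metis DiffE singletonI)
    obtain Z where Z: "finite Z" "Z \<subseteq> T" "\<one> \<in> ((d <#\<^bsub>R\<^esub> S) \<inter> stage \<rho>) \<cdot> Z"
      using ext_finite_support[OF \<rho>(4)] by blast
    have "Y \<subseteq> T'" if T': "T' \<in> fam \<rho>" "T' \<noteq> T" "Z \<subseteq> T'" for T'
    proof
      have sT': "subring T' R" "D \<subseteq> T'"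
        using T'(1) fam_subset family_subring family_overring by blast+
      have "(d <#\<^bsub>R\<^esub> S) \<inter> stage \<rho> \<subseteq> d <#\<^bsub>R\<^esub> T'"
        using \<rho>(3)[OF T'(1,2)] by (auto simp: l_coset_def)
      then have "((d <#\<^bsub>R\<^esub> S) \<inter> stage \<rho>) \<cdot> T' \<subseteq> d <#\<^bsub>R\<^esub> T'"
        by (intro ext_least sT' submodules_scale subring_self_submodule dc)
      then have "\<one> \<in> d <#\<^bsub>R\<^esub> T'"
        using Z(3) ext_mono[OF order_refl T'(3)] by blast
      \<comment> \<open>The common denominator \<open>d\<close> of \<open>Y\<close> is invertible in
        \<open>T'\<close>, so \<open>T'\<close> contains \<open>Y\<close>.\<close>
      then obtain u where u: "u \<in> T'" "\<one> = d \<otimes> u" by (auto simp: mem_scale)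
      fix x assume x: "x \<in> Y"
      have "(d \<otimes> x) \<otimes> u \<in> T'"
        using d(2) x u(1) sT'(2) by (intro subringE(6)[OF sT'(1), of "d \<otimes> x" u]) auto
      moreover have "(d \<otimes> x) \<otimes> u = x"
        using u x dc Yc subringE(1)[OF sT'(1)] by (intro unit_cancel) auto
      ultimately show "x \<in> T'" by simp
    qed
    then show ?thesis using Z \<rho>(1) by blast
  qed
  then obtain Z \<rho> where Z: "\<And>T. T \<in> \<Theta> \<Longrightarrow> T \<notin> fam \<alpha> \<Longrightarrow>
      finite (Z T) \<and> Z T \<subseteq> T \<and> \<rho> T < \<alpha> \<and> (\<forall>T'\<in>fam (\<rho> T). T' \<noteq> T \<longrightarrow> Z T \<subseteq> T' \<longrightarrow> Y \<subseteq> T')"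
    by metis
  define B where "B W = {T \<in> overrings R D. W \<subseteq> T}" for W
  have Bopen: "openin (zariski R D) (B W)" if "finite W" "W \<subseteq> carrier R" for W
    unfolding zariski_def openin_topology_generated_by_iff B_def
    using that by (intro generate_topology_on.Basis) blast
  let ?G = "\<Theta> - fam \<alpha>"
  let ?U = "insert (B Y) ((\<lambda>T. B (Z T)) ` ?G)"
  have sub: "\<Theta> \<subseteq> overrings R D" and cpt: "compactin (zariski R D) \<Theta>"
    using family by (auto simp: pre_jaffard_family_def)
  have "\<forall>U\<in>?U. openin (zariski R D) U"
  proof
    fix U assume "U \<in> ?U"
    then consider "U = B Y" | T where "T \<in> \<Theta>" "T \<notin> fam \<alpha>" "U = B (Z T)"
      by blast
    then show "openin (zariski R D) U"
    proof cases
      case 1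
      then show ?thesis using Bopen[OF Y(1) Yc] by simp
    next
      case 2
      have "Z T \<subseteq> carrier R"
        using Z[OF 2(1,2)] subringE(1)[OF family_subring[OF 2(1)]] by blast
      then show ?thesis using Bopen[of "Z T"] Z[OF 2(1,2)] 2(3) by simp
    qed
  qed
  moreover have "\<Theta> \<subseteq> \<Union>?U"
  proof
    fix T assume T: "T \<in> \<Theta>"
    show "T \<in> \<Union>?U"
    proof (cases "T \<in> fam \<alpha>")
      case True
      then have "T \<in> B Y" using sub T stage_subset[OF True] Y(2) by (auto simp: B_def)
      then show ?thesis by blast
    next
      case False
      then have "T \<in> B (Z T)" using Z[OF T False] sub T by (auto simp: B_def)
      then show ?thesis using T False by blast
    qed
  qed
  ultimately obtain \<F> where \<F>: "finite \<F>" "\<F> \<subseteq> ?U" "\<Theta> \<subseteq> \<Union>\<F>"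
    using cpt unfolding compactin_def by meson
  \<comment> \<open>Apart from the neighbourhood of the rings containing \<open>Y\<close>, the
    finite subcover comes from finitely many removed members; these form the exceptional set
    \<open>F\<close>.\<close>
  then have "finite (\<F> - {B Y})" "\<F> - {B Y} \<subseteq> (\<lambda>T. B (Z T)) ` ?G" by auto
  then obtain F where F: "finite F" "F \<subseteq> ?G" "\<F> - {B Y} = (\<lambda>T. B (Z T)) ` F"
    by (meson finite_subset_image)
  obtain \<beta>0 where \<beta>0: "\<beta>0 < \<alpha>"
    using nf by (auto simp: is_first_def not_le)
  \<comment> \<open>A single stage beyond all the finitely many removal stages;
    \<open>\<beta>0\<close> keeps the maximum meaningful when \<open>F\<close> is empty.\<close>
  define \<beta> where "\<beta> = Max (insert \<beta>0 (\<rho> ` F))"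
  have \<beta>: "\<beta> < \<alpha>" "\<And>T. T \<in> F \<Longrightarrow> \<rho> T \<le> \<beta>"
    using F Z \<beta>0 by (auto simp: \<beta>_def)
  show ?thesis
  proof (rule that[OF \<beta>(1) F(1)])
    show "F \<subseteq> \<Theta>" "F \<inter> fam \<alpha> = {}" using F(2) by auto
    fix T assume T: "T \<in> fam \<beta>" "T \<notin> F"
    then have "T \<in> B Y \<or> (\<exists>T1\<in>F. T \<in> B (Z T1))"
      using \<F>(3) F(3) fam_subset[of \<beta>] by blast
    then show "Y \<subseteq> T"
    proof (elim disjE bexE)
      fix T1 assume T1: "T1 \<in> F" "T \<in> B (Z T1)"
      then have "T \<in> fam (\<rho> T1)" "T \<noteq> T1"
        using fam_antimono[OF \<beta>(2)] T by auto
      then show ?thesis using Z[of T1] F(2) T1 by (auto simp: B_def)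
    qed (auto simp: B_def)
  qed
qed

end


section \<open>Stable semistar operations\<close>

context field
begin

lemma SStar_D:
  assumes "s \<in> carrier (SStar_st R E)"
  shows "\<And>I. I \<in> submodules R E \<Longrightarrow> s I \<in> submodules R E"
    "\<And>I. I \<in> submodules R E \<Longrightarrow> I \<subseteq> s I"
    "\<And>I J. I \<in> submodules R E \<Longrightarrow> J \<in> submodules R E \<Longrightarrow> I \<subseteq> J \<Longrightarrow> s I \<subseteq> s J"
    "\<And>I. I \<in> submodules R E \<Longrightarrow> s (s I) = s I"
    "\<And>x I. I \<in> submodules R E \<Longrightarrow> x \<in> carrier R \<Longrightarrow> s (x <#\<^bsub>R\<^esub> I) = x <#\<^bsub>R\<^esub> s I"
    "\<And>I J. I \<in> submodules R E \<Longrightarrow> J \<in> submodules R E \<Longrightarrow> s (I \<inter> J) = s I \<inter> s J"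
    "s \<in> extensional (submodules R E)"
  using assms by (auto simp: SStar_st_def semistar_operation_def stable_operation_def PiE_def)

lemma SStar_I:
  assumes "\<And>I. I \<in> submodules R E \<Longrightarrow> s I \<in> submodules R E"
    "\<And>I. I \<in> submodules R E \<Longrightarrow> I \<subseteq> s I"
    "\<And>I J. I \<in> submodules R E \<Longrightarrow> J \<in> submodules R E \<Longrightarrow> I \<subseteq> J \<Longrightarrow> s I \<subseteq> s J"
    "\<And>I. I \<in> submodules R E \<Longrightarrow> s (s I) \<subseteq> s I"
    "\<And>x I. I \<in> submodules R E \<Longrightarrow> x \<in> carrier R \<Longrightarrow> s (x <#\<^bsub>R\<^esub> I) = x <#\<^bsub>R\<^esub> s I"
    "\<And>I J. I \<in> submodules R E \<Longrightarrow> J \<in> submodules R E \<Longrightarrow> s (I \<inter> J) = s I \<inter> s J"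
    "s \<in> extensional (submodules R E)"
  shows "s \<in> carrier (SStar_st R E)"
proof -
  have "s (s I) = s I" if "I \<in> submodules R E" for I
    using assms(1,2,4) that by (simp add: subset_antisym)
  then show ?thesis
    using assms by (auto simp: SStar_st_def semistar_operation_def stable_operation_def PiE_def)
qed

lemma mem_scale_self:
  assumes "subring T R" "N \<in> submodules R T" "T \<subseteq> N" "x \<in> carrier R"
  shows "x \<in> x <#\<^bsub>R\<^esub> N"
proof -
  have "x = x \<otimes> \<one>" "\<one> \<in> N"
    using assms subringE(3)[OF assms(1)] by auto
  then show ?thesis
    unfolding mem_scale by blast
qed

text \<open>Homogeneity takes \<open>x\<close> out of the operation, and 1 lies in \<open>T\<close>.
  By stability, a module with \<open>x\<close> in its closure can thus be cut down to the multiples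
  of \<open>x\<close> without losing \<open>x\<close>.\<close>

lemma SStar_mem_scale:
  assumes s: "s \<in> carrier (SStar_st R E)" and E: "subring E R" and T: "subring T R" "E \<subseteq> T" and x: "x \<in> carrier R"
  shows "x \<in> s (x <#\<^bsub>R\<^esub> T)"
proof -
  have T': "T \<in> submodules R E"
    by (rule overring_submodule[OF E T])
  have "x \<in> x <#\<^bsub>R\<^esub> s T"
    using SStar_D(1,2)[OF s T'] T(2) by (intro mem_scale_self[OF E] x) auto
  then show ?thesis
    using SStar_D(5)[OF s T' x] by simp
qed

text \<open>For \<open>t\<close> in \<open>T\<close> the inclusion of tI in \<open>I\<close> passes
  to closures by monotonicity, and homogeneity takes \<open>t\<close> out.\<close>

lemma SStar_overring_closed:
  assumes s: "s \<in> carrier (SStar_st R E)" and E: "subring E R" and T: "subring T R" "E \<subseteq> T"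
    and I: "I \<in> submodules R T"
  shows "s I \<in> submodules R T"
proof (rule submodulesI[OF T(1)])
  have I': "I \<in> submodules R E"
    using submodules_antimono[OF E T] I by blast
  note D = submodulesD[OF E SStar_D(1)[OF s I']]
  show "s I \<subseteq> carrier R" "\<zero> \<in> s I" using D by auto
  show "x \<oplus> y \<in> s I" if "x \<in> s I" "y \<in> s I" for x y
    using D(3) that .
  show "t \<otimes> x \<in> s I" if t: "t \<in> T" and x: "x \<in> s I" for t x
  proof -
    have tc: "t \<in> carrier R" using t subringE(1)[OF T(1)] by auto
    have "t <#\<^bsub>R\<^esub> I \<subseteq> I"
      using t submodulesD(4)[OF T(1) I] by (auto simp: mem_scale)
    then have "s (t <#\<^bsub>R\<^esub> I) \<subseteq> s I"
      by (intro SStar_D(3)[OF s] submodules_scale E I' tc)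
    then show ?thesis
      using SStar_D(5)[OF s I' tc] x by (auto simp: l_coset_def)
  qed
qed

lemma SStar_restrict:
  assumes s: "s \<in> carrier (SStar_st R E)" and E: "subring E R" and T: "subring T R" "E \<subseteq> T"
  shows "restrict s (submodules R T) \<in> carrier (SStar_st R T)"
proof -
  have sub: "I \<in> submodules R E" if "I \<in> submodules R T" for I
    using submodules_antimono[OF E T] that by blast
  note cl = SStar_overring_closed[OF s E T]
  show ?thesis
    by (rule SStar_I)
      (use sub cl SStar_D[OF s] submodules_scale[OF T(1)] submodules_Int[OF T(1)] in \<open>simp_all\<close>)
qed

text \<open>Stability treats one intersection at a time; \<open>A\<close> supplies the value for an
  empty index set.\<close>

lemma SStar_finite_Inter:
  assumes s: "s \<in> carrier (SStar_st R E)" and E: "subring E R" and "finite G"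
    and A: "A \<in> submodules R E" "y \<in> s A" and f: "\<And>T. T \<in> G \<Longrightarrow> f T \<in> submodules R E \<and> y \<in> s (f T)"
  shows "A \<inter> (\<Inter>T\<in>G. f T) \<in> submodules R E \<and> y \<in> s (A \<inter> (\<Inter>T\<in>G. f T))"
  using assms(3) f
proof induct
  case empty
  then show ?case using A by simp
next
  case (insert T G)
  have "A \<inter> (\<Inter>T\<in>insert T G. f T) = (A \<inter> (\<Inter>T\<in>G. f T)) \<inter> f T" by auto
  then show ?case
    using insert SStar_D(6)[OF s, of "A \<inter> (\<Inter>T\<in>G. f T)" "f T"] submodules_Int[OF E] by auto
qed

lemma partial_order_SStar: "partial_order (SStar_st R E)"
proof
  fix s s' assume *: "s \<sqsubseteq>\<^bsub>SStar_st R E\<^esub> s'" "s' \<sqsubseteq>\<^bsub>SStar_st R E\<^esub> s"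
    "s \<in> carrier (SStar_st R E)" "s' \<in> carrier (SStar_st R E)"
  have "s = s'"
    using SStar_D(7)[OF *(3)] SStar_D(7)[OF *(4)] *(1,2)
    by (intro extensionalityI[of _ "submodules R E"]) (auto simp: SStar_st_def)
  then show "s .=\<^bsub>SStar_st R E\<^esub> s'" by (simp add: SStar_st_def)
qed (auto simp: SStar_st_def)

end

lemma partial_order_product:
  assumes "\<And>j. j \<in> J \<Longrightarrow> partial_order (P j)"
  shows "partial_order (product_order J P)"
proof -
  have refl: "x \<sqsubseteq>\<^bsub>P j\<^esub> x" if "j \<in> J" "x \<in> carrier (P j)" for j x
    using assms[OF that(1)] that(2) by (simp add: partial_order_def weak_partial_order.le_refl)
  have antisym: "x = y" if "j \<in> J" "x \<in> carrier (P j)" "y \<in> carrier (P j)" "x \<sqsubseteq>\<^bsub>P j\<^esub> y" "y \<sqsubseteq>\<^bsub>P j\<^esub> x" for j x y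
    using assms[OF that(1)] that by (auto intro: partial_order.le_antisym)
  have trans: "x \<sqsubseteq>\<^bsub>P j\<^esub> z" if "j \<in> J" "x \<in> carrier (P j)" "y \<in> carrier (P j)" "z \<in> carrier (P j)"
    "x \<sqsubseteq>\<^bsub>P j\<^esub> y" "y \<sqsubseteq>\<^bsub>P j\<^esub> z" for j x y z
    using assms[OF that(1)] that by (meson partial_order_def weak_partial_order.le_trans)
  show ?thesis
  proof
    fix f g assume *: "f \<sqsubseteq>\<^bsub>product_order J P\<^esub> g" "g \<sqsubseteq>\<^bsub>product_order J P\<^esub> f"
      "f \<in> carrier (product_order J P)" "g \<in> carrier (product_order J P)"
    have "f = g"
      using * antisym by (intro PiE_ext[of _ J "\<lambda>j. carrier (P j)"]) (auto simp: product_order_def PiE_iff)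
    then show "f .=\<^bsub>product_order J P\<^esub> g" by (simp add: product_order_def)
  next
    fix f g h assume *: "f \<sqsubseteq>\<^bsub>product_order J P\<^esub> g" "g \<sqsubseteq>\<^bsub>product_order J P\<^esub> h"
      "f \<in> carrier (product_order J P)" "g \<in> carrier (product_order J P)" "h \<in> carrier (product_order J P)"
    have "f j \<sqsubseteq>\<^bsub>P j\<^esub> h j" if "j \<in> J" for j
      by (rule trans[OF that, of _ "g j"]) (use * that in \<open>auto simp: product_order_def\<close>)
    then show "f \<sqsubseteq>\<^bsub>product_order J P\<^esub> h"
      by (simp add: product_order_def)
  qed (auto simp: product_order_def PiE_iff intro: refl)
qed

section \<open>Gluing operations on overrings\<close>

context field
begin

text \<open>The inverse of restriction sends \<open>(u\<^sub>T)\<close> to \<open>I \<mapsto> \<Inter> u\<^sub>T(IT)\<close>. Restricting back to \<open>T\<close> gives \<open>u\<^sub>T\<close>, since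
  \<open>IB = ITB = K\<close> for a nonzero \<open>T\<close>-module \<open>I\<close> and \<open>B \<noteq> T\<close>.\<close>

lemma SStar_glue:
  assumes D: "subring D R" and ne: "\<Phi> \<noteq> {}" and flat: "\<And>T. T \<in> \<Phi> \<Longrightarrow> eflat D T"
    and ext: "\<And>T B. T \<in> \<Phi> \<Longrightarrow> B \<in> \<Phi> \<Longrightarrow> T \<noteq> B \<Longrightarrow> T \<cdot> B = carrier R"
    and u: "\<And>T. T \<in> \<Phi> \<Longrightarrow> u T \<in> carrier (SStar_st R T)"
  defines "g \<equiv> (\<lambda>I\<in>submodules R D. \<Inter>T\<in>\<Phi>. u T (I \<cdot> T))"
  shows "g \<in> carrier (SStar_st R D)" "\<And>T I. T \<in> \<Phi> \<Longrightarrow> I \<in> submodules R T \<Longrightarrow> g I = u T I"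
proof -
  have T: "subring T R" "D \<subseteq> T" if "T \<in> \<Phi>" for T
    using flat[OF that] eflatD by auto
  have IT: "I \<cdot> T \<in> submodules R T" if "I \<in> submodules R D" "T \<in> \<Phi>" for I T
    using submodulesD(1,2)[OF D that(1)] by (intro ext_submodule T[OF that(2)]) auto
  have uT: "u T (I \<cdot> T) \<in> submodules R T" if "I \<in> submodules R D" "T \<in> \<Phi>" for I T
    using SStar_D(1)[OF u[OF that(2)] IT[OF that]] .
  have incl: "submodules R T \<subseteq> submodules R D" if "T \<in> \<Phi>" for T
    using submodules_antimono[OF D T[OF that]] .
  have g: "g I = (\<Inter>T\<in>\<Phi>. u T (I \<cdot> T))" if "I \<in> submodules R D" for I
    using that by (simp add: g_def)
  have gT: "g I \<subseteq> u T (I \<cdot> T)" if "I \<in> submodules R D" "T \<in> \<Phi>" for I T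
    using that by (auto simp: g)
  have sub: "g I \<in> submodules R D" if "I \<in> submodules R D" for I
    unfolding g[OF that] using uT[OF that] incl by (intro submodules_INT D ne) blast
  show "g \<in> carrier (SStar_st R D)"
  proof (rule SStar_I)
    show "g I \<in> submodules R D" if "I \<in> submodules R D" for I
      using sub[OF that] .
    show "I \<subseteq> g I" if I: "I \<in> submodules R D" for I
    proof -
      have "I \<subseteq> u T (I \<cdot> T)" if "T \<in> \<Phi>" for T
        using ext_incl[OF T(1)[OF that] submodulesD(1)[OF D I]] SStar_D(2)[OF u[OF that] IT[OF I that]] by blast
      then show ?thesis by (auto simp: g[OF I])
    qed
    show "g I \<subseteq> g J" if IJ: "I \<in> submodules R D" "J \<in> submodules R D" "I \<subseteq> J" for I J
    proof -
      have "u T (I \<cdot> T) \<subseteq> u T (J \<cdot> T)" if "T \<in> \<Phi>" for T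
        using IJ that by (intro SStar_D(3)[OF u] IT ext_mono) auto
      then show ?thesis using IJ by (auto simp: g)
    qed
    show "g (g I) \<subseteq> g I" if I: "I \<in> submodules R D" for I
    proof -
      have "u T (g I \<cdot> T) \<subseteq> u T (I \<cdot> T)" if t: "T \<in> \<Phi>" for T
      proof -
        have "g I \<cdot> T \<subseteq> u T (I \<cdot> T)"
          by (intro ext_least T(1) t uT I gT)
        then have "u T (g I \<cdot> T) \<subseteq> u T (u T (I \<cdot> T))"
          by (intro SStar_D(3)[OF u] IT uT t sub I)
        then show ?thesis using SStar_D(4)[OF u[OF t] IT[OF I t]] by simp
      qed
      then have "(\<Inter>T\<in>\<Phi>. u T (g I \<cdot> T)) \<subseteq> (\<Inter>T\<in>\<Phi>. u T (I \<cdot> T))"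
        by blast
      then show ?thesis
        by (simp only: g[OF sub[OF I], symmetric] g[OF I, symmetric])
    qed
    show "g (x <#\<^bsub>R\<^esub> I) = x <#\<^bsub>R\<^esub> g I" if I: "I \<in> submodules R D" and x: "x \<in> carrier R" for x I
    proof -
      have xI: "x <#\<^bsub>R\<^esub> I \<in> submodules R D" by (intro submodules_scale D I x)
      have "u T ((x <#\<^bsub>R\<^esub> I) \<cdot> T) = x <#\<^bsub>R\<^esub> u T (I \<cdot> T)" if t: "T \<in> \<Phi>" for T
      proof -
        have "I \<noteq> {}" using submodulesD(2)[OF D I] by auto
        then show ?thesis
          using ext_scale[OF T(1)[OF t] submodulesD(1)[OF D I] _ x] SStar_D(5)[OF u[OF t] IT[OF I t] x] by simp
      qed
      then have eq: "g (x <#\<^bsub>R\<^esub> I) = (\<Inter>T\<in>\<Phi>. x <#\<^bsub>R\<^esub> u T (I \<cdot> T))"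
        by (simp add: g[OF xI])
      have c: "u T (I \<cdot> T) \<subseteq> carrier R" if "T \<in> \<Phi>" for T
        using submodulesD(1)[OF T(1)[OF that] uT[OF I that]] .
      show ?thesis
      proof
        show "x <#\<^bsub>R\<^esub> g I \<subseteq> g (x <#\<^bsub>R\<^esub> I)"
          unfolding eq by (auto simp: l_coset_def g[OF I])
        show "g (x <#\<^bsub>R\<^esub> I) \<subseteq> x <#\<^bsub>R\<^esub> g I"
        proof
          fix z assume "z \<in> g (x <#\<^bsub>R\<^esub> I)"
          then have z: "\<exists>i\<in>u T (I \<cdot> T). z = x \<otimes> i" if "T \<in> \<Phi>" for T
            using that unfolding eq by (auto simp: mem_scale)
          show "z \<in> x <#\<^bsub>R\<^esub> g I"
          \<comment> \<open>Scaling by a nonzero \<open>x\<close> is injective and commutes with the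
            intersection. For zero, any member \<open>T0\<close> shows that \<open>z\<close> is
            zero.\<close>
          proof (cases "x = \<zero>")
            case True
            obtain T0 where "T0 \<in> \<Phi>" using ne by blast
            then obtain i where i: "i \<in> carrier R" "z = \<zero> \<otimes> i"
              using z[OF \<open>T0 \<in> \<Phi>\<close>] c[OF \<open>T0 \<in> \<Phi>\<close>] True by blast
            then have "z = x \<otimes> \<zero>" using True by simp
            then show ?thesis
              using submodulesD(2)[OF D sub[OF I]] unfolding mem_scale by blast
          next
            case False
            have "z \<otimes> inv x \<in> u T (I \<cdot> T) \<and> z \<in> carrier R" if t: "T \<in> \<Phi>" for T
            proof -
              obtain i where "i \<in> u T (I \<cdot> T)" "z = x \<otimes> i" using z[OF t] by blast
              then show ?thesis using mult_inv_cancel(1)[OF x False, of i] c[OF t] x by auto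
            qed
            then have "z \<otimes> inv x \<in> g I" "z \<in> carrier R" using ne by (auto simp: g[OF I])
            then show ?thesis
              using mult_inv_cancel(2)[OF x False, of z] unfolding mem_scale by metis
          qed
        qed
      qed
    qed
    show "g (I \<inter> J) = g I \<inter> g J" if IJ: "I \<in> submodules R D" "J \<in> submodules R D" for I J
    proof -
      \<comment> \<open>Flatness makes extension to \<open>T\<close> commute with the intersection;
        then stability of \<open>u T\<close> applies.\<close>
      have "u T ((I \<inter> J) \<cdot> T) = u T (I \<cdot> T) \<inter> u T (J \<cdot> T)" if t: "T \<in> \<Phi>" for T
        unfolding eflat_ext_Int[OF flat[OF t] IJ] using IT IJ t by (intro SStar_D(6)[OF u]) auto
      then show ?thesis
        using g[OF submodules_Int[OF D IJ]] g[OF IJ(1)] g[OF IJ(2)] by auto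
    qed
    show "g \<in> extensional (submodules R D)" by (simp add: g_def)
  qed
  show "g I = u T I" if t: "T \<in> \<Phi>" and I: "I \<in> submodules R T" for T I
  proof
    have ID: "I \<in> submodules R D" using incl[OF t] I by blast
    have IT': "I \<cdot> T = I" by (rule ext_id[OF T(1)[OF t] I])
    show "g I \<subseteq> u T I"
      using gT[OF ID t] IT' by simp
    have I0: "I \<subseteq> carrier R" "\<zero> \<in> I" using submodulesD[OF T(1)[OF t] I] by auto
    have "u T I \<subseteq> u B (I \<cdot> B)" if b: "B \<in> \<Phi>" "B \<noteq> T" for B
    proof (cases "I = {\<zero>}")
      case True
      \<comment> \<open>Homogeneity at the scalar 0 forces the closure of the zero module to be
        zero.\<close>
      have z: "\<zero> <#\<^bsub>R\<^esub> I = I" using scale_zero[OF I0(1)] True by auto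
      have "u T I = \<zero> <#\<^bsub>R\<^esub> u T I"
        using SStar_D(5)[OF u[OF t] I zero_closed] z by simp
      also have "\<dots> = {\<zero>}"
        using submodulesD(1,2)[OF T(1)[OF t] SStar_D(1)[OF u[OF t] I]] by (intro scale_zero) auto
      finally show ?thesis
        using submodulesD(2)[OF T(1)[OF b(1)] uT[OF ID b(1)]] by simp
    next
      case False
      then obtain i where i: "i \<in> I" "i \<noteq> \<zero>" using I0 by blast
      then have ic: "i \<in> carrier R" using I0 by auto
      have sc: "i <#\<^bsub>R\<^esub> T \<subseteq> I"
      proof
        fix z assume "z \<in> i <#\<^bsub>R\<^esub> T"
        then obtain w where w: "w \<in> T" "z = i \<otimes> w" by (auto simp: mem_scale)
        then have "z = w \<otimes> i" using ic subringE(1)[OF T(1)[OF t]] by (auto intro: m_comm)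
        then show "z \<in> I" using submodulesD(4)[OF T(1)[OF t] I w(1) i(1)] by simp
      qed
      \<comment> \<open>The module \<open>I\<close> contains iT, so its extension to
        \<open>B\<close> contains i(TB) = iK = K.\<close>
      have "carrier R \<subseteq> I \<cdot> B"
      proof
        fix x assume x: "x \<in> carrier R"
        have "x = i \<otimes> (x \<otimes> inv i)" "x \<otimes> inv i \<in> carrier R"
          using mult_inv_cancel(2)[OF ic i(2) x] inv_nonzero[OF ic i(2)] x by auto
        then have "x \<in> i <#\<^bsub>R\<^esub> (T \<cdot> B)"
          unfolding mem_scale ext[OF t b(1) b(2)[symmetric]] by blast
        then have "x \<in> (i <#\<^bsub>R\<^esub> T) \<cdot> B"
          using ext_scale[OF T(1)[OF b(1)] subringE(1,4)[OF T(1)[OF t]] ic] by simp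
        then show "x \<in> I \<cdot> B"
          using ext_mono[OF sc order_refl] by blast
      qed
      then have "carrier R \<subseteq> u B (I \<cdot> B)"
        using SStar_D(2)[OF u[OF b(1)] IT[OF ID b(1)]] by blast
      then show ?thesis
        using submodulesD(1)[OF T(1)[OF t] SStar_D(1)[OF u[OF t] I]] by blast
    qed
    then have "u T I \<subseteq> u B (I \<cdot> B)" if "B \<in> \<Phi>" for B
      using that IT' by (cases "B = T") simp_all
    then show "u T I \<subseteq> g I"
      unfolding g[OF ID] by blast
  qed
qed

text \<open>Restriction \<open>f\<close> and gluing \<open>g\<close> are mutually inverse:
  \<open>rep\<close> recovers an operation from its restrictions, and \<open>SStar_glue\<close>
  recovers the components. Restriction reflects the order because \<open>rep\<close> computes
  closures from values on modules over members of \<Phi>.\<close>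

lemma SStar_order_isomorphic_product:
  assumes D: "subring D R" and ne: "\<Phi> \<noteq> {}" and flat: "\<And>T. T \<in> \<Phi> \<Longrightarrow> eflat D T"
    and ext: "\<And>T B. T \<in> \<Phi> \<Longrightarrow> B \<in> \<Phi> \<Longrightarrow> T \<noteq> B \<Longrightarrow> T \<cdot> B = carrier R"
    and rep: "\<And>s I. s \<in> carrier (SStar_st R D) \<Longrightarrow> I \<in> submodules R D \<Longrightarrow> s I = (\<Inter>T\<in>\<Phi>. s (I \<cdot> T))"
  shows "order_isomorphic (SStar_st R D) (product_order \<Phi> (\<lambda>T. SStar_st R T))"
proof -
  let ?A = "SStar_st R D" and ?B = "product_order \<Phi> (\<lambda>T. SStar_st R T)"
  define f where "f s = (\<lambda>T\<in>\<Phi>. restrict s (submodules R T))" for s :: "'a set \<Rightarrow> 'a set"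
  define g where "g u = (\<lambda>I\<in>submodules R D. \<Inter>T\<in>\<Phi>. u T (I \<cdot> T))" for u :: "'a set \<Rightarrow> 'a set \<Rightarrow> 'a set"
  have T: "subring T R" "D \<subseteq> T" if "T \<in> \<Phi>" for T
    using flat[OF that] eflatD by auto
  have incl: "submodules R T \<subseteq> submodules R D" if "T \<in> \<Phi>" for T
    using submodules_antimono[OF D T[OF that]] .
  have IT: "I \<cdot> T \<in> submodules R T" if "I \<in> submodules R D" "T \<in> \<Phi>" for I T
    using submodulesD(1,2)[OF D that(1)] by (intro ext_submodule T[OF that(2)]) auto
  have carrB: "carrier ?B = (\<Pi>\<^sub>E T\<in>\<Phi>. carrier (SStar_st R T))"
    by (simp add: product_order_def)
  have glue1: "g u \<in> carrier ?A" if "\<And>T. T \<in> \<Phi> \<Longrightarrow> u T \<in> carrier (SStar_st R T)" for u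
    unfolding g_def by (rule SStar_glue(1)[OF D ne flat ext that])
  have glue2: "g u I = u T I" if "\<And>T. T \<in> \<Phi> \<Longrightarrow> u T \<in> carrier (SStar_st R T)" "T \<in> \<Phi>" "I \<in> submodules R T"
    for u T I
    unfolding g_def by (rule SStar_glue(2)[OF D ne flat ext that])
  have "bij_betw f (carrier ?A) (carrier ?B)"
  proof (rule bij_betw_byWitness[where f' = g])
    show "f ` carrier ?A \<subseteq> carrier ?B"
      unfolding carrB using SStar_restrict[OF _ D T] by (auto simp: f_def PiE_iff)
    show "g ` carrier ?B \<subseteq> carrier ?A"
    proof
      fix s assume "s \<in> g ` carrier ?B"
      then obtain u where "u \<in> carrier ?B" "s = g u" by blast
      then show "s \<in> carrier ?A"
        using glue1[of u] by (auto simp: carrB PiE_iff)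
    qed
    show "\<forall>s\<in>carrier ?A. g (f s) = s"
    proof
      fix s assume s: "s \<in> carrier ?A"
      show "g (f s) = s"
      proof (rule extensionalityI[of _ "submodules R D"])
        fix I assume I: "I \<in> submodules R D"
        have "f s T (I \<cdot> T) = s (I \<cdot> T)" if "T \<in> \<Phi>" for T
          using IT[OF I that] that by (simp add: f_def)
        then show "g (f s) I = s I"
          using rep[OF s I] I by (simp add: g_def)
      qed (use SStar_D(7)[OF s] in \<open>auto simp: g_def\<close>)
    qed
    show "\<forall>u\<in>carrier ?B. f (g u) = u"
    proof
      fix u assume u: "u \<in> carrier ?B"
      then have uT: "u T \<in> carrier (SStar_st R T)" if "T \<in> \<Phi>" for T
        using that by (auto simp: carrB)
      show "f (g u) = u"
      proof (rule extensionalityI[of _ \<Phi>])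
        fix T assume t: "T \<in> \<Phi>"
        have "restrict (g u) (submodules R T) = u T"
          using SStar_D(7)[OF uT[OF t]] glue2[OF uT t]
          by (intro extensionalityI[of _ "submodules R T"]) auto
        then show "f (g u) T = u T" using t by (simp add: f_def)
      qed (use u in \<open>auto simp: f_def carrB PiE_iff\<close>)
    qed
  qed
  moreover have "f s \<sqsubseteq>\<^bsub>?B\<^esub> f s' \<longleftrightarrow> s \<sqsubseteq>\<^bsub>?A\<^esub> s'" if s: "s \<in> carrier ?A" "s' \<in> carrier ?A" for s s'
  proof
    assume *: "f s \<sqsubseteq>\<^bsub>?B\<^esub> f s'"
    have le: "s I \<subseteq> s' I" if "T \<in> \<Phi>" "I \<in> submodules R T" for T I
      using * that by (auto simp: product_order_def SStar_st_def f_def)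
    have "s I \<subseteq> s' I" if I: "I \<in> submodules R D" for I
      unfolding rep[OF s(1) I] rep[OF s(2) I] using le IT[OF I] by (intro INF_superset_mono) auto
    then show "s \<sqsubseteq>\<^bsub>?A\<^esub> s'" by (simp add: SStar_st_def)
  next
    assume *: "s \<sqsubseteq>\<^bsub>?A\<^esub> s'"
    then show "f s \<sqsubseteq>\<^bsub>?B\<^esub> f s'"
      using incl by (auto simp: product_order_def SStar_st_def f_def; blast)
  qed
  moreover have po: "partial_order ?A" "partial_order ?B"
    by (rule partial_order_SStar, rule partial_order_product, rule partial_order_SStar)
  ultimately show ?thesis
    unfolding order_isomorphic_def order_emb_def by (auto simp: partial_order_def intro!: exI[of _ f])
qed

end

section \<open>Descent along the derived sequence\<close>

context pre_jaffard
begin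

text \<open>Well-founded induction on \<alpha>, with \<open>x\<close> generalized because the
  hypothesis for a smaller \<beta> is applied to a multiple \<open>y\<close> of \<open>x\<close>,
  and \<beta> depends on \<open>y\<close>.\<close>

lemma semistar_descent:
  assumes s: "s \<in> carrier (SStar_st R D)" and I: "I \<in> submodules R D"
    and "\<And>T. T \<in> \<Theta> \<Longrightarrow> T \<notin> fam \<alpha> \<Longrightarrow> x \<in> s (I \<cdot> T)" "x \<in> s (I \<cdot> stage \<alpha>)"
  shows "x \<in> s I"
  using assms(3,4)
proof (induction \<alpha> arbitrary: x rule: less_induct)
  case (less \<alpha>)
  note ID = submodulesD[OF D I]
  have ext: "I \<cdot> T \<in> submodules R T" "I \<cdot> T \<in> submodules R D" if "subring T R" "D \<subseteq> T" for T
  proof -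
    show "I \<cdot> T \<in> submodules R T" using ID(1,2) by (intro ext_submodule that) auto
    then show "I \<cdot> T \<in> submodules R D" using submodules_antimono[OF D that] by blast
  qed
  note st = stage_subring stage_overring
  show ?case
  proof (cases "is_first \<alpha>")
    case True
    then show ?thesis
      using less.prems(2) ext_id[OF D I] by (simp add: derived_ring_first)
  next
    case False
    have xc: "x \<in> carrier R"
      using submodulesD(1)[OF D SStar_D(1)[OF s ext(2)[OF st]]] less.prems(2) by blast
    \<comment> \<open>The second factor makes each element of \<open>J\<close> a multiple of
      \<open>x\<close>, so that it inherits membership in closures from \<open>x\<close>, while
      \<open>x\<close> remains in \<open>s J\<close>.\<close>
    define J where "J = I \<cdot> stage \<alpha> \<inter> (x <#\<^bsub>R\<^esub> D)"
    have xD: "x <#\<^bsub>R\<^esub> D \<in> submodules R D"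
      by (intro submodules_scale D subring_self_submodule xc)
    have Js: "J \<in> submodules R D"
      unfolding J_def by (intro submodules_Int D ext st xD)
    have "x \<in> s J"
      unfolding J_def SStar_D(6)[OF s ext(2)[OF st] xD]
      using less.prems(2) SStar_mem_scale[OF s D D order_refl xc] by simp
    moreover have "J \<subseteq> s I"
    proof
      fix y assume y: "y \<in> J"
      obtain d where d: "d \<in> D" "y = x \<otimes> d" using y by (auto simp: J_def mem_scale)
      have dc: "d \<in> carrier R" using d subringE(1)[OF D] by auto
      have yc: "y \<in> carrier R" using d xc dc by simp
      have up: "y \<in> s N" if "N \<in> submodules R D" "x \<in> s N" for N
      proof -
        have "d \<otimes> x \<in> s N" using submodulesD(4)[OF D SStar_D(1)[OF s that(1)] d(1) that(2)] .
        then show ?thesis using d(2) xc dc by (simp add: m_comm)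
      qed
      obtain Y where Y: "finite Y" "Y \<subseteq> stage \<alpha>" "y \<in> I \<cdot> Y"
        using y ext_finite_support[of y I "stage \<alpha>"] by (auto simp: J_def)
      obtain \<beta> F where F: "\<beta> < \<alpha>" "finite F" "F \<subseteq> \<Theta>" "F \<inter> fam \<alpha> = {}" "\<And>T. T \<in> fam \<beta> \<Longrightarrow> T \<notin> F \<Longrightarrow> Y \<subseteq> T"
        using stage_cofinite[OF False Y(1,2)] by metis
      show "y \<in> s I"
      proof (rule less.IH[OF F(1)])
        show "y \<in> s (I \<cdot> T)" if "T \<in> \<Theta>" "T \<notin> fam \<beta>" for T
        proof (rule up)
          show "I \<cdot> T \<in> submodules R D" using that family_subring family_overring by (intro ext) auto
          show "x \<in> s (I \<cdot> T)"
            using less.prems(1) that fam_antimono[OF less_imp_le[OF F(1)]] by blast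
        qed
        let ?E = "stage \<beta>"
        note E = stage_subring[of \<beta>]
        note IE = ext[OF st, of \<beta>]
        show "y \<in> s (I \<cdot> ?E)"
        proof (cases "fam \<beta> = {}")
          case True
          \<comment> \<open>With nothing left at stage \<beta> the ring is K, so \<open>y\<close>
            lies in the extension itself.\<close>
          then have "Y \<subseteq> ?E" using Y(2) subringE(1)[OF stage_subring] by (auto simp: stage_eq)
          then have "y \<in> I \<cdot> ?E" using ext_mono[OF order_refl] Y(3) by blast
          then show ?thesis using SStar_D(2)[OF s IE(2)] by blast
        next
          case ne: False
          \<comment> \<open>Cutting down to multiples of \<open>y\<close> makes almost all
            conditions trivial: for \<open>T\<close> in \<open>fam \<beta>\<close> outside
            \<open>F\<close>, \<open>y\<close> lies in \<open>I \<cdot> T\<close>, so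
            \<open>N \<cdot> T\<close> is just yT. By completeness only finitely many intersections
            remain.\<close>
          define N where "N = I \<cdot> ?E \<inter> (y <#\<^bsub>R\<^esub> ?E)"
          have yE: "y <#\<^bsub>R\<^esub> ?E \<in> submodules R ?E"
            by (intro submodules_scale subring_self_submodule E yc)
          have N: "N \<in> submodules R ?E" "N \<in> submodules R D"
            using submodules_Int[OF E IE(1) yE] submodules_antimono[OF D st] by (auto simp: N_def)
          have fam: "subring T R" "D \<subseteq> T" "?E \<subseteq> T" "T \<in> \<Theta>" if "T \<in> fam \<beta>" for T
            using that fam_subset family_subring family_overring stage_subset by blast+
          have NT: "N \<cdot> T = I \<cdot> T \<inter> (y <#\<^bsub>R\<^esub> T)" if T: "T \<in> fam \<beta>" for T
          proof -
            have "?E \<cdot> T = T"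
              using fam(1,3)[OF T] subringE(3)[OF E] by (intro ext_unital)
            then have "(y <#\<^bsub>R\<^esub> ?E) \<cdot> T = y <#\<^bsub>R\<^esub> T"
              using ext_scale[OF fam(1)[OF T] subringE(1,4)[OF E] yc] by simp
            moreover have "(I \<cdot> ?E) \<cdot> T = I \<cdot> T"
              using ID(1,2) by (intro ext_ext E fam T) auto
            ultimately show ?thesis
              unfolding N_def eflat_ext_Int[OF fam_flat[OF T] IE(1) yE] by simp
          qed
          have yT: "y <#\<^bsub>R\<^esub> T \<in> submodules R D" if T: "T \<in> fam \<beta>" for T
            by (intro submodules_scale D overring_submodule fam T yc)
          \<comment> \<open>These exceptions occur at stage \<beta> but no longer at stage \<alpha>,
            so the assumption on \<open>x\<close> covers them.\<close>
          define G where "G = F \<inter> fam \<beta>"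
          have "(y <#\<^bsub>R\<^esub> ?E) \<inter> (\<Inter>T\<in>G. N \<cdot> T) \<in> submodules R D \<and> y \<in> s ((y <#\<^bsub>R\<^esub> ?E) \<inter> (\<Inter>T\<in>G. N \<cdot> T))"
          proof (rule SStar_finite_Inter[OF s D])
            show "finite G" using F(2) by (simp add: G_def)
            show "y <#\<^bsub>R\<^esub> ?E \<in> submodules R D"
              using yE submodules_antimono[OF D st] by blast
            show "y \<in> s (y <#\<^bsub>R\<^esub> ?E)"
              by (rule SStar_mem_scale[OF s D st yc])
            fix T assume "T \<in> G"
            then have T: "T \<in> fam \<beta>" "T \<in> F" by (auto simp: G_def)
            have "x \<in> s (I \<cdot> T)"
              using less.prems(1) fam(4)[OF T(1)] T(2) F(4) by blast
            then have "y \<in> s (I \<cdot> T)"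
              by (intro up ext fam T(1))
            then have "y \<in> s (N \<cdot> T)"
              using SStar_mem_scale[OF s D fam(1,2)[OF T(1)] yc]
              unfolding NT[OF T(1)] SStar_D(6)[OF s ext(2)[OF fam(1,2)[OF T(1)]] yT[OF T(1)]] by simp
            moreover have "N \<cdot> T \<in> submodules R D"
              unfolding NT[OF T(1)] by (intro submodules_Int D ext fam T(1) yT)
            ultimately show "N \<cdot> T \<in> submodules R D \<and> y \<in> s (N \<cdot> T)" by simp
          qed
          moreover have "(y <#\<^bsub>R\<^esub> ?E) \<inter> (\<Inter>T\<in>G. N \<cdot> T) \<subseteq> N"
          proof
            fix z assume z: "z \<in> (y <#\<^bsub>R\<^esub> ?E) \<inter> (\<Inter>T\<in>G. N \<cdot> T)"
            then obtain e where e: "e \<in> ?E" "z = y \<otimes> e" by (auto simp: mem_scale)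
            show "z \<in> N"
            proof (rule stage_complete[OF ne N(1)])
              fix T assume T: "T \<in> fam \<beta>"
              show "z \<in> N \<cdot> T"
              proof (cases "T \<in> F")
                case True
                then show ?thesis using z T by (auto simp: G_def)
              next
                case nF: False
                have eT: "e \<in> T" using e(1) fam(3)[OF T] by blast
                have "y \<in> I \<cdot> T"
                  using ext_mono[OF order_refl F(5)[OF T nF]] Y(3) by blast
                then have "e \<otimes> y \<in> I \<cdot> T"
                  by (rule submodulesD(4)[OF fam(1)[OF T] ext(1)[OF fam(1,2)[OF T]] eT])
                moreover have "e \<otimes> y = z"
                  using e yc subringE(1)[OF E] by (auto intro: m_comm)
                ultimately show ?thesis
                  unfolding NT[OF T] using eT e(2) by (auto simp: mem_scale)
              qed
            qed
          qed
          ultimately have "y \<in> s N"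
            using SStar_D(3)[OF s _ N(2)] by blast
          moreover have "s N \<subseteq> s (I \<cdot> ?E)"
            by (intro SStar_D(3)[OF s N(2) IE(2)]) (simp add: N_def)
          ultimately show ?thesis by blast
        qed
      qed
    qed
    then have "s J \<subseteq> s (s I)"
      by (rule SStar_D(3)[OF s Js SStar_D(1)[OF s I]])
    ultimately show ?thesis using SStar_D(4)[OF s I] by blast
  qed
qed

section \<open>The family \<Theta>' and the product decomposition\<close>

abbreviation refined :: "'i::wellorder \<Rightarrow> 'a set set" where
  "refined \<alpha> \<equiv> (\<Theta> - fam \<alpha>) \<union> {stage \<alpha>}"

lemma refined_flat: "T \<in> refined \<alpha> \<Longrightarrow> eflat D T"
  using family_flat stage_flat by blast

text \<open>Two members of \<Theta> generate K by independence over \<open>D\<close>; a removed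
  member and \<open>stage \<alpha>\<close> do so by \<open>removed_ext_stage\<close>.\<close>

lemma refined_ext:
  assumes "T \<in> refined \<alpha>" "B \<in> refined \<alpha>" "T \<noteq> B"
  shows "T \<cdot> B = carrier R"
proof -
  have c: "C \<subseteq> carrier R" if "C \<in> refined \<alpha>" for C
    using refined_flat[OF that] eflatD(2) subringE(1) by blast
  consider "T = stage \<alpha>" "B \<in> \<Theta>" "B \<notin> fam \<alpha>" | "B = stage \<alpha>" "T \<in> \<Theta>" "T \<notin> fam \<alpha>" | "T \<in> \<Theta>" "B \<in> \<Theta>"
    using assms by blast
  then show ?thesis
  proof cases
    case 1
    then show ?thesis using removed_ext_stage by blast
  next
    case 2
    then show ?thesis using removed_ext_stage ext_comm[OF c[OF assms(1)] c[OF assms(2)]] by metis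
  next
    case 3
    show ?thesis
      by (rule independent_ext_carrier[OF quotient_field])
        (use 3 family_subring family_overring family_independent assms(3) in auto)
  qed
qed

text \<open>One inclusion is monotonicity along the extension of \<open>I\<close>; the other is
  \<open>semistar_descent\<close>.\<close>

lemma refined_representation:
  assumes s: "s \<in> carrier (SStar_st R D)" and I: "I \<in> submodules R D"
  shows "s I = (\<Inter>T\<in>refined \<alpha>. s (I \<cdot> T))"
proof
  show "s I \<subseteq> (\<Inter>T\<in>refined \<alpha>. s (I \<cdot> T))"
  proof (rule INT_greatest)
    fix T assume T': "T \<in> refined \<alpha>"
    note T = eflatD(2,3)[OF refined_flat[OF T']]
    have ne: "I \<subseteq> carrier R" "I \<noteq> {}" using submodulesD(1,2)[OF D I] by auto
    show "s I \<subseteq> s (I \<cdot> T)"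
      using ext_submodule[OF T(1) ne] submodules_antimono[OF D T] ext_incl[OF T(1) ne(1)]
      by (intro SStar_D(3)[OF s I]) auto
  qed
  show "(\<Inter>T\<in>refined \<alpha>. s (I \<cdot> T)) \<subseteq> s I"
    using semistar_descent[OF s I, of \<alpha>] by blast
qed

end

theorem corollary7p6:
  fixes K :: "('a, 'b) ring_scheme" (structure)
    and D :: "'a set"
    and \<Theta> \<Theta>' :: "'a set set"
    and \<alpha> :: "'i::wellorder"
  assumes "quotient_field K D"
    and "pre_jaffard_family K D \<Theta>"
    and "\<Theta>' = (\<Theta> - derived_family K D \<Theta> \<alpha>) \<union> {derived_ring K D \<Theta> \<alpha>}"
  shows "(\<forall>s\<in>carrier (SStar_st K D). \<forall>I\<in>submodules K D. s I = (\<Inter>T\<in>\<Theta>'. s (I \<cdot>\<^bsub>K\<^esub> T))) \<and>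
         order_isomorphic (SStar_st K D) (product_order \<Theta>' (\<lambda>T. SStar_st K T))"
proof -
  interpret pre_jaffard K D \<Theta>
    using assms(1,2) by (auto simp: pre_jaffard_def pre_jaffard_axioms_def quotient_field_def)
  show ?thesis
    unfolding assms(3)
  proof (intro conjI ballI)
    show "order_isomorphic (SStar_st K D) (product_order (refined \<alpha>) (\<lambda>T. SStar_st K T))"
      by (rule SStar_order_isomorphic_product[OF D])
        (simp, fact refined_flat, fact refined_ext, fact refined_representation)
  qed (rule refined_representation)
qed

end
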